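(* Let $f(\alpha)=2\cdot 5^{\alpha}-6^{\alpha+1}+4\cdot 7^{\alpha}$ for real $\alpha$, and let $x_0\approx -3.09997$ be a root of the equation $f(\alpha)=0$. Let $n\ge 3$ and let $B_n\in\Omega_n$ be a polyomino chain having $n$ squares. Then, for every real $\alpha$ with $x_0<\alpha<0$, $$\chi_\alpha(Z_n)\le \chi_\alpha(B_n)\le \chi_\alpha(L_n),$$ where $Z_n$ is the zigzag chain and $L_n$ is the linear chain with $n$ squares. The right equality holds if and only if $B_n\cong L_n$, and the left equality holds if and only if $B_n\cong Z_n$.
   Context: For a graph $G$ and a nonzero real number $\alpha$, the general sum-connectivity index is $\chi_\alpha(G)=\sum_{uv\in E(G)}(d_u+d_v)^\alpha$, where $d_u$ is the degree of the vertex $u$. A polyomino system is a connected geometric figure obtained by concatenating congruent squares side to side in the plane so that the figure divides the plane into one infinite (external) region and a number of finite (internal) regions, all internal regions being congruent squares. Two squares are adjacent if they share a side. A polyomino chain is a polyomino system in which every square is adjacent to at most two other squares; the squares are arranged in a linear order in which exactly the consecutive squares are adjacent (so for $n\ge 2$ there are two terminal squares; the cyclic $2\times 2$ block of four squares is not considered a chain). A polyomino chain is identified with its graph: vertices are the corners of the squares, edges are the sides of the squares. Degrees are taken in this graph, and $\cong$ denotes graph isomorphism. A square adjacent to exactly one (respectively two) other square(s) is called terminal (respectively non-terminal). A kink is a non-terminal square having a vertex of degree 2. The linear chain $L_n$ is the polyomino chain with $n$ squares and no kinks. The zigzag chain $Z_n$ is the polyomino chain with $n$ squares consisting of only kinks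 and terminal squares. A segment is a maximal linear chain in a polyomino chain, including the kinks and/or terminal squares at its ends; its length is its number of squares. A segment is external if it contains a terminal square, and internal otherwise. $\Omega_n$ is the collection of all polyomino chains with $n$ squares in which no internal segment of length 3 has an edge connecting two vertices of degree 3. *)

theory Defs
  imports "HOL-Analysis.Analysis"
begin

section \<open>Simple graphs and the general sum-connectivity index\<close>

text \<open>A simple graph is a pair of a vertex set and an edge set, each edge being the set of its
  two endpoints.\<close>

type_synonym 'a graph = "'a set \<times> 'a set set"

definition degree :: "'a graph \<Rightarrow> 'a \<Rightarrow> nat" where
  "degree G v = card {e \<in> snd G. v \<in> e}"

definition sum_connectivity :: "real \<Rightarrow> 'a graph \<Rightarrow> real" where
  "sum_connectivity \<alpha> G = (\<Sum>e\<in>snd G. real (\<Sum>v\<in>e. degree G v) powr \<alpha>)"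

definition graph_iso :: "'a graph \<Rightarrow> 'b graph \<Rightarrow> bool" where
  "graph_iso G H \<longleftrightarrow>
     (\<exists>\<phi>. bij_betw \<phi> (fst G) (fst H) \<and>
          (\<forall>u\<in>fst G. \<forall>v\<in>fst G. {u, v} \<in> snd G \<longleftrightarrow> {\<phi> u, \<phi> v} \<in> snd H))"

section \<open>Squares\<close>

text \<open>Congruent squares joined side to side may be taken to be cells of the unit grid;
  \<open>(x, y)\<close> stands for the closed square with lower left corner \<open>(x, y)\<close>.\<close>

type_synonym point = "int \<times> int"
type_synonym cell = "int \<times> int"

definition corners :: "cell \<Rightarrow> point set" where
  "corners c = (case c of (x, y) \<Rightarrow> {(x, y), (x + 1, y), (x, y + 1), (x + 1, y + 1)})"

definition sides :: "cell \<Rightarrow> point set set" where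
  "sides c = (case c of (x, y) \<Rightarrow>
     {{(x, y), (x + 1, y)}, {(x, y), (x, y + 1)},
      {(x + 1, y), (x + 1, y + 1)}, {(x, y + 1), (x + 1, y + 1)}})"

definition adjacent :: "cell \<Rightarrow> cell \<Rightarrow> bool" where
  "adjacent c d \<longleftrightarrow> c \<noteq> d \<and> sides c \<inter> sides d \<noteq> {}"

definition to_plane :: "point \<Rightarrow> real \<times> real" where
  "to_plane p = (real_of_int (fst p), real_of_int (snd p))"

definition square :: "cell \<Rightarrow> (real \<times> real) set" where
  "square c = cbox (to_plane c) (to_plane c + (1, 1))"

section \<open>Polyomino systems and polyomino chains\<close>

definition figure :: "cell set \<Rightarrow> (real \<times> real) set" where
  "figure S = (\<Union>c\<in>S. frontier (square c))"

text \<open>The last two conditions say that the drawn sides divide the plane into exactly one infinite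
  region and finite regions which are exactly the squares of the system. They exclude
  holes, including those enclosed by squares that touch only at a corner.\<close>

definition polyomino_system :: "cell set \<Rightarrow> bool" where
  "polyomino_system S \<longleftrightarrow>
     finite S \<and> S \<noteq> {} \<and>
     (\<forall>c\<in>S. \<forall>d\<in>S. (c, d) \<in> {(a, b). a \<in> S \<and> b \<in> S \<and> adjacent a b}\<^sup>*) \<and>
     (\<exists>!R. R \<in> components (- figure S) \<and> \<not> bounded R) \<and>
     {R \<in> components (- figure S). bounded R} = (\<lambda>c. interior (square c)) ` S"

definition polyomino_chain :: "cell set \<Rightarrow> bool" where
  "polyomino_chain S \<longleftrightarrow>
     polyomino_system S \<and>
     (\<forall>c\<in>S. card {d \<in> S. adjacent c d} \<le> 2) \<and>
     (\<exists>cs. distinct cs \<and> set cs = S \<and>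
        (\<forall>i<length cs. \<forall>j<length cs.
           adjacent (cs ! i) (cs ! j) \<longleftrightarrow> i = Suc j \<or> j = Suc i))"

definition graph_of :: "cell set \<Rightarrow> point graph" where
  "graph_of S = (\<Union>c\<in>S. corners c, \<Union>c\<in>S. sides c)"

definition terminal :: "cell set \<Rightarrow> cell \<Rightarrow> bool" where
  "terminal S c \<longleftrightarrow> c \<in> S \<and> card {d \<in> S. adjacent c d} = 1"

definition non_terminal :: "cell set \<Rightarrow> cell \<Rightarrow> bool" where
  "non_terminal S c \<longleftrightarrow> c \<in> S \<and> card {d \<in> S. adjacent c d} = 2"

definition kink :: "cell set \<Rightarrow> cell \<Rightarrow> bool" where
  "kink S c \<longleftrightarrow> non_terminal S c \<and> (\<exists>v\<in>corners c. degree (graph_of S) v = 2)"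

definition linear_chain :: "cell set \<Rightarrow> bool" where
  "linear_chain S \<longleftrightarrow> polyomino_chain S \<and> (\<forall>c\<in>S. \<not> kink S c)"

definition zigzag_chain :: "cell set \<Rightarrow> bool" where
  "zigzag_chain S \<longleftrightarrow> polyomino_chain S \<and> (\<forall>c\<in>S. kink S c \<or> terminal S c)"

text \<open>In \<open>segment S T\<close>, linearity of \<open>T\<close> is judged within \<open>T\<close> itself, so the squares at the ends
  of \<open>T\<close> may be kinks or terminal squares of \<open>S\<close>.\<close>

definition segment :: "cell set \<Rightarrow> cell set \<Rightarrow> bool" where
  "segment S T \<longleftrightarrow> T \<subseteq> S \<and> linear_chain T \<and>
     (\<forall>T'. T \<subseteq> T' \<and> T' \<subseteq> S \<and> linear_chain T' \<longrightarrow> T' = T)"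

definition external_segment :: "cell set \<Rightarrow> cell set \<Rightarrow> bool" where
  "external_segment S T \<longleftrightarrow> segment S T \<and> (\<exists>c\<in>T. terminal S c)"

definition internal_segment :: "cell set \<Rightarrow> cell set \<Rightarrow> bool" where
  "internal_segment S T \<longleftrightarrow> segment S T \<and> \<not> external_segment S T"

definition Omega :: "nat \<Rightarrow> cell set set" where
  "Omega n = {S. polyomino_chain S \<and> card S = n \<and>
     \<not> (\<exists>T. internal_segment S T \<and> card T = 3 \<and>
            (\<exists>e\<in>snd (graph_of T). \<forall>v\<in>e. degree (graph_of S) v = 3))}"

end

theory Submission
  imports Defs
begin

text \<open>Call an inner square a turn if the chain bends there. The squares around a vertex are consecutive
  in the chain, so every degree is one more than the number of squares at the vertex, and a local
  computation writes the index as a constant plus a sum over pairs of consecutive squares of a weight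
  that depends only on which of the two are turns. This needs that between two turns
  separated by one square the chain does not make a U-turn, which is what membership in \<open>\<Omega>\<^sub>n\<close> says.
  With \<open>p d = d powr \<alpha>\<close>, the weight of an inner pair is \<open>3 p 6\<close>, \<open>p 5 + 2 p 7\<close> or \<open>2 p 6 + p 8\<close> for
  zero, one or two turns. Strict convexity gives \<open>p 5 + 2 p 7 < 3 p 6\<close> between the roots \<open>x0\<close> and \<open>0\<close>
  of the defining equation, so the pairs are compared one by one. That squares of a chain do not touch at a corner
  only is the Jordan curve theorem, applied to a loop through the squares and the common corner.\<close>

text \<open>The obstacle is that each outer side of a straight inner square can feel both
  neighbours. If both neighbours are turns bending to opposite sides, each outer side carries
  \<open>p 7\<close>, one per neighbour. If they bend to the same side, the outer sides carry
  \<open>p 8\<close> and \<open>p 6\<close>, which is not a sum of one term per neighbour. Between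
  consecutive turns there is no such ambiguity: they bend opposite ways, since otherwise four
  squares would form a 2 x 2 block. The left side of the defining equation is twice the difference
  of the inner weights for one turn and for zero turns. Adjacency alone says nothing about contact
  at a corner. It is excluded by the clauses on regions: the two missing cells at such a corner
  would both lie in the single unbounded region, although the loop separates them. Equality in every
  pair fixes which squares are turns. If none or all of the inner squares are turns, this determines
  every step up to a symmetry of the grid, so equality of the indices becomes isomorphism.\<close>

lemma adjacent_cases:
  "adjacent (x, y) (a, b) \<longleftrightarrow>
     a = x + 1 \<and> b = y \<or> a = x - 1 \<and> b = y \<or> a = x \<and> b = y + 1 \<or> a = x \<and> b = y - 1"
proof
  assume "adjacent (x, y) (a, b)"
  then obtain e where e: "e \<in> sides (x, y)" "e \<in> sides (a, b)" and ne: "x \<noteq> a \<or> y \<noteq> b"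
    by (auto simp: adjacent_def)
  have "e = {(a, b), (a + 1, b)} \<or> e = {(a, b), (a, b + 1)} \<or>
    e = {(a + 1, b), (a + 1, b + 1)} \<or> e = {(a, b + 1), (a + 1, b + 1)}"
    using e(2) by (simp add: sides_def)
  with e(1) ne show "a = x + 1 \<and> b = y \<or> a = x - 1 \<and> b = y \<or> a = x \<and> b = y + 1 \<or> a = x \<and> b = y - 1"
    by (elim disjE) (auto simp: sides_def doubleton_eq_iff)
qed (elim disjE conjE; simp add: adjacent_def sides_def doubleton_eq_iff)

lemma adjacent_iff: "adjacent (x, y) (x', y') \<longleftrightarrow> \<bar>x - x'\<bar> + \<bar>y - y'\<bar> = 1"
  unfolding adjacent_cases by (auto simp: abs_if split: if_splits)

lemma adjacent_offsets:
  "adjacent c d \<longleftrightarrow> d = (fst c + 1, snd c) \<or> d = (fst c - 1, snd c) \<or>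
     d = (fst c, snd c + 1) \<or> d = (fst c, snd c - 1)"
proof -
  obtain x y a b where "c = (x, y)" "d = (a, b)" by (metis surj_pair)
  then show ?thesis by (simp add: adjacent_cases)
qed

lemma mem_corners: "(a, b) \<in> corners (x, y) \<longleftrightarrow> (a = x \<or> a = x + 1) \<and> (b = y \<or> b = y + 1)"
  by (auto simp: corners_def)

lemma corners_meet_iff:
  "corners (x, y) \<inter> corners (x', y') \<noteq> {} \<longleftrightarrow> \<bar>x - x'\<bar> \<le> 1 \<and> \<bar>y - y'\<bar> \<le> 1"
proof
  assume "\<bar>x - x'\<bar> \<le> 1 \<and> \<bar>y - y'\<bar> \<le> 1"
  then have "(max x x', max y y') \<in> corners (x, y) \<inter> corners (x', y')"
    by (auto simp: mem_corners max_def)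
  then show "corners (x, y) \<inter> corners (x', y') \<noteq> {}" by blast
qed (auto simp: mem_corners)

lemma sum_sides:
  fixes f :: "point set \<Rightarrow> real"
  shows "(\<Sum>e\<in>sides (x, y). f e) = f {(x, y), (x + 1, y)} + f {(x, y), (x, y + 1)} +
    f {(x + 1, y), (x + 1, y + 1)} + f {(x, y + 1), (x + 1, y + 1)}"
  by (simp add: sides_def doubleton_eq_iff)

lemma finite_sides: "finite (sides c)"
  by (auto simp: sides_def split: prod.split)

text \<open>The summands belong to the unit edges to the right, upwards, to the left and downwards;
  such an edge is present iff one of the two cells that it separates is.\<close>

lemma degree_graph_of:
  "degree (graph_of S) (x, y) =
     of_bool ((x, y) \<in> S \<or> (x, y - 1) \<in> S) + of_bool ((x, y) \<in> S \<or> (x - 1, y) \<in> S) +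
     of_bool ((x - 1, y) \<in> S \<or> (x - 1, y - 1) \<in> S) + of_bool ((x, y - 1) \<in> S \<or> (x - 1, y - 1) \<in> S)"
proof -
  define E1 E2 E3 E4 where E: "E1 = {(x, y), (x + 1, y)}" "E2 = {(x, y), (x, y + 1)}"
    "E3 = {(x - 1, y), (x, y)}" "E4 = {(x, y - 1), (x, y)}"
  have ne: "E1 \<noteq> E2" "E1 \<noteq> E3" "E1 \<noteq> E4" "E2 \<noteq> E3" "E2 \<noteq> E4" "E3 \<noteq> E4"
    by (simp_all add: E doubleton_eq_iff)
  define b1 b2 b3 b4 where b: "b1 \<longleftrightarrow> (x, y) \<in> S \<or> (x, y - 1) \<in> S" "b2 \<longleftrightarrow> (x, y) \<in> S \<or> (x - 1, y) \<in> S"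
    "b3 \<longleftrightarrow> (x - 1, y) \<in> S \<or> (x - 1, y - 1) \<in> S" "b4 \<longleftrightarrow> (x, y - 1) \<in> S \<or> (x - 1, y - 1) \<in> S"
  have eq: "{e \<in> snd (graph_of S). (x, y) \<in> e} =
    (if b1 then {E1} else {}) \<union> (if b2 then {E2} else {}) \<union> (if b3 then {E3} else {}) \<union> (if b4 then {E4} else {})"
    (is "?L = ?R")
  proof
    show "?L \<subseteq> ?R"
    proof
      fix e assume "e \<in> ?L"
      then obtain a b where ab: "(a, b) \<in> S" "e \<in> sides (a, b)" "(x, y) \<in> e"
        by (auto simp: graph_of_def)
      from ab(2,3) have "(e = {(a, b), (a + 1, b)} \<and> (x = a \<or> x = a + 1) \<and> y = b) \<or>
        (e = {(a, b), (a, b + 1)} \<and> x = a \<and> (y = b \<or> y = b + 1)) \<or>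
        (e = {(a + 1, b), (a + 1, b + 1)} \<and> x = a + 1 \<and> (y = b \<or> y = b + 1)) \<or>
        (e = {(a, b + 1), (a + 1, b + 1)} \<and> (x = a \<or> x = a + 1) \<and> y = b + 1)"
        unfolding sides_def by auto
      then have "e = E1 \<and> a = x \<and> (b = y \<or> b = y - 1) \<or>
        e = E2 \<and> (a = x \<or> a = x - 1) \<and> b = y \<or>
        e = E3 \<and> a = x - 1 \<and> (b = y \<or> b = y - 1) \<or>
        e = E4 \<and> (a = x \<or> a = x - 1) \<and> b = y - 1"
        unfolding E by (elim disjE conjE) (simp_all)
      then show "e \<in> ?R" using ab(1) b by (elim disjE conjE) simp_all
    qed
    have "e \<in> ?L" if "d \<in> S" "e \<in> sides d" "(x, y) \<in> e" for d e
      using that by (auto simp: graph_of_def)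
    then have "b1 \<Longrightarrow> E1 \<in> ?L" "b2 \<Longrightarrow> E2 \<in> ?L" "b3 \<Longrightarrow> E3 \<in> ?L" "b4 \<Longrightarrow> E4 \<in> ?L"
      unfolding b E by (elim disjE; force simp: sides_def)+
    then show "?R \<subseteq> ?L" by (auto split: if_splits)
  qed
  show ?thesis
    unfolding degree_def eq b[symmetric]
    by (cases b1; cases b2; cases b3; cases b4) (simp_all add: ne ne[symmetric])
qed

lemma card_cells_at:
  "card {c \<in> S. (x, y) \<in> corners c} = of_bool ((x, y) \<in> S) + of_bool ((x - 1, y) \<in> S) +
     of_bool ((x, y - 1) \<in> S) + of_bool ((x - 1, y - 1) \<in> S)"
proof -
  have eq: "{c \<in> S. (x, y) \<in> corners c} = (if (x, y) \<in> S then {(x, y)} else {}) \<union>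
    (if (x - 1, y) \<in> S then {(x - 1, y)} else {}) \<union>
    (if (x, y - 1) \<in> S then {(x, y - 1)} else {}) \<union>
    (if (x - 1, y - 1) \<in> S then {(x - 1, y - 1)} else {})"
    by (auto simp: mem_corners)
  show ?thesis
    unfolding eq by (cases "(x, y) \<in> S"; cases "(x - 1, y) \<in> S"; cases "(x, y - 1) \<in> S"; cases "(x - 1, y - 1) \<in> S") simp_all
qed

section \<open>Regions of the figure\<close>

text \<open>The arc and the segment form a Jordan curve. In the ball around \<open>p\<close> this
  curve is only a diameter, so it leaves two half discs there, and \<open>R\<close> connects them.
  Their union with \<open>R\<close> is connected and avoids the curve. Yet \<open>p\<close>, like
  every point of the curve, is a limit of both the inside and the outside, so that union meets
  both.\<close>

lemma crossing_separates:
  fixes p w :: complex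
  assumes g: "arc g" "pathstart g = p - w" "pathfinish g = p + w"
    and meet: "path_image g \<inter> closed_segment (p - w) (p + w) \<subseteq> {p - w, p + w}"
    and off: "path_image g \<inter> ball p r = {}"
    and r: "0 < r" "r \<le> norm w"
    and R: "connected R" "R \<inter> path_image g = {}" "R \<inter> closed_segment (p - w) (p + w) = {}"
    and s: "0 < s" "s * norm w < r" "p + of_real s * (\<i> * w) \<in> R" "p - of_real s * (\<i> * w) \<in> R"
  shows False
proof -
  have w: "w \<noteq> 0" using r by auto
  define X where "X = path_image (g +++ linepath (p + w) (p - w))"
  have X: "X = path_image g \<union> closed_segment (p - w) (p + w)"
    unfolding X_def using g(3) by (subst path_image_join) (auto simp: closed_segment_commute)
  have "simple_path (g +++ linepath (p + w) (p - w))"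
  proof (rule simple_path_join_loop)
    show "arc (linepath (p + w) (p - w))" using w by (intro arc_linepath) (simp add: eq_neg_iff_add_eq_0 flip: mult_2)
    show "path_image g \<inter> path_image (linepath (p + w) (p - w)) \<subseteq> {pathstart g, pathstart (linepath (p + w) (p - w))}"
      using meet g by (simp add: closed_segment_commute)
  qed (use g in auto)
  then have J: "open (inside X)" "open (outside X)" "inside X \<noteq> {}" "inside X \<inter> outside X = {}"
      "inside X \<union> outside X = - X" "frontier (inside X) = X" "frontier (outside X) = X"
    unfolding X_def using g by (simp_all add: Jordan_inside_outside)
  \<comment> \<open>\<open>h\<close> is \<open>w\<close> turned by a right angle, so the sign of the
    inner product with \<open>h\<close> tells the two half discs apart.\<close>
  define h where "h = \<i> * w"
  have wh: "w \<bullet> h = 0" by (simp add: h_def inner_complex_def)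
  have hh: "h \<bullet> h > 0" using w by (simp add: h_def)
  define H where "H = (\<lambda>e::real. ball p r \<inter> {z. 0 < (e *\<^sub>R h) \<bullet> z - (e *\<^sub>R h) \<bullet> p})"
  have conn: "connected (H e)" for e
  proof -
    have "H e = ball p r \<inter> {z. (e *\<^sub>R h) \<bullet> p < (e *\<^sub>R h) \<bullet> z}" by (auto simp: H_def)
    then have "convex (H e)" by (simp only:) (intro convex_Int convex_ball convex_halfspace_gt)
    then show ?thesis by (rule convex_connected)
  qed
  have seg: "z \<in> closed_segment (p - w) (p + w) \<longleftrightarrow> (\<exists>t. \<bar>t\<bar> \<le> 1 \<and> z = p + t *\<^sub>R w)" for z
  proof
    assume "z \<in> closed_segment (p - w) (p + w)"
    then obtain u where u: "0 \<le> u" "u \<le> 1" "z = (1 - u) *\<^sub>R (p - w) + u *\<^sub>R (p + w)"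
      by (auto simp: in_segment)
    then have "z = p + (2 * u - 1) *\<^sub>R w" by (simp add: complex_eq_iff algebra_simps)
    then show "\<exists>t. \<bar>t\<bar> \<le> 1 \<and> z = p + t *\<^sub>R w" using u by (intro exI[of _ "2 * u - 1"]) auto
  next
    assume "\<exists>t. \<bar>t\<bar> \<le> 1 \<and> z = p + t *\<^sub>R w"
    then obtain t where t: "\<bar>t\<bar> \<le> 1" "z = p + t *\<^sub>R w" by blast
    then have "z = (1 - (1 + t) / 2) *\<^sub>R (p - w) + ((1 + t) / 2) *\<^sub>R (p + w)"
      by (simp add: complex_eq_iff field_simps)
    then show "z \<in> closed_segment (p - w) (p + w)" using t(1) unfolding in_segment
      by (intro exI[of _ "(1 + t) / 2"]) auto
  qed
  have disj: "H e \<inter> X = {}" for e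
  proof -
    have False if "z \<in> ball p r" "z \<in> X" "0 < (e *\<^sub>R h) \<bullet> z - (e *\<^sub>R h) \<bullet> p" for z
    proof -
      have "z \<in> closed_segment (p - w) (p + w)" using that off by (auto simp: X)
      then obtain t where "z = p + t *\<^sub>R w" by (auto simp: seg)
      with that(3) wh show False by (simp add: inner_add_right inner_commute)
    qed
    then show ?thesis by (auto simp: H_def)
  qed
  \<comment> \<open>A point in neither half disc is on the line through \<open>p\<close> along
    \<open>w\<close>. As \<open>r \<le> norm w\<close>, it is then on the segment.\<close>
  have cover: "z \<in> H 1 \<union> H (-1)" if z: "z \<in> ball p r" "z \<notin> X" for z
  proof (rule ccontr)
    assume "z \<notin> H 1 \<union> H (-1)"
    then have eq: "h \<bullet> (z - p) = 0" using z by (auto simp: H_def inner_diff_right)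
    define t where "t = (w \<bullet> (z - p)) / (w \<bullet> w)"
    have "w \<bullet> w \<noteq> 0" using w by simp
    have "(z - p) = t *\<^sub>R w"
    proof -
      have "(w \<bullet> w) *\<^sub>R (z - p) = (w \<bullet> (z - p)) *\<^sub>R w"
        using eq unfolding h_def by (simp add: complex_eq_iff inner_complex_def algebra_simps) algebra
      then have "inverse (w \<bullet> w) *\<^sub>R (w \<bullet> w) *\<^sub>R (z - p) = inverse (w \<bullet> w) *\<^sub>R (w \<bullet> (z - p)) *\<^sub>R w"
        by (rule arg_cong)
      then show ?thesis using \<open>w \<bullet> w \<noteq> 0\<close> by (simp add: t_def divide_inverse mult.commute)
    qed
    then have zt: "z = p + t *\<^sub>R w" by (simp add: algebra_simps)
    then have "\<bar>t\<bar> * norm w < norm w" using z(1) r(2) by (simp add: dist_norm)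
    then have "\<bar>t\<bar> \<le> 1" using w by simp
    then have "z \<in> X" using zt by (auto simp: X seg)
    then show False using z by simp
  qed
  have "p \<in> X" unfolding X Un_iff seg by (intro disjI2 exI[of _ 0]) simp
  have near: "\<exists>z. z \<in> V \<and> (z \<in> H 1 \<or> z \<in> H (-1))" if "frontier V = X" "V \<inter> X = {}" for V
  proof -
    have "p \<in> closure V" using that \<open>p \<in> X\<close> by (auto simp: frontier_def)
    then obtain z where "z \<in> V" "dist z p < r" using r by (auto simp: closure_approachable)
    then have "z \<in> ball p r" "z \<notin> X" using that by (auto simp: dist_commute)
    with cover \<open>z \<in> V\<close> show ?thesis by auto
  qed
  have q: "p + of_real s * (\<i> * w) \<in> H 1" "p - of_real s * (\<i> * w) \<in> H (-1)"
    using s hh by (auto simp: H_def h_def dist_norm norm_mult inner_add_right inner_diff_right scaleR_conv_of_real[symmetric])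
  define M where "M = R \<union> H 1 \<union> H (-1)"
  have RH: "connected (R \<union> H 1)" by (rule connected_Un[OF R(1) conn]) (use q s in blast)
  have "connected M" unfolding M_def by (rule connected_Un[OF RH conn]) (use q s in blast)
  moreover have "M \<subseteq> inside X \<union> outside X" unfolding J(5) M_def using disj R by (auto simp: X)
  ultimately have "inside X \<inter> M = {} \<or> outside X \<inter> M = {}"
    using connectedD[of M "inside X" "outside X"] J by blast
  moreover obtain z where "z \<in> inside X" "z \<in> M"
    using near[of "inside X"] J by (auto simp: M_def)
  moreover obtain z' where "z' \<in> outside X" "z' \<in> M"
    using near[of "outside X"] J by (auto simp: M_def)
  ultimately show False by blast
qed


section \<open>Squares and the components of the complement of their figure\<close>

lemma square_eq: "square (x, y) = {real_of_int x..x + 1} \<times> {real_of_int y..y + 1}"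
  by (simp add: square_def to_plane_def cbox_Pair_eq)

lemma interior_square_eq: "interior (square (x, y)) = {real_of_int x<..<x + 1} \<times> {real_of_int y<..<y + 1}"
  by (simp add: square_eq interior_Times)

lemma interior_square_unique:
  assumes "z \<in> interior (square c)" "z \<in> square d"
  shows "d = c"
proof -
  obtain x y a b p q where eq: "c = (x, y)" "d = (a, b)" "z = (p, q)" by (metis surj_pair)
  then have "x < p" "p < x + 1" "y < q" "q < y + 1" "a \<le> p" "p \<le> a + 1" "b \<le> q" "q \<le> b + 1"
    using assms interior_square_eq[of x y] square_eq[of a b] by auto
  then have "a = x" "b = y" by linarith+
  then show ?thesis using eq by simp
qed

lemma closed_square: "closed (square c)" unfolding square_def by (rule closed_cbox)

lemma square_decomp: "square c = interior (square c) \<union> frontier (square c)"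
  using closure_Un_frontier[of "square c"] closed_square[of c] interior_subset[of "square c"]
  by (auto simp: frontier_def)

lemma frontier_square_subset: "frontier (square c) \<subseteq> square c" using square_decomp by blast

lemma interior_square_disjoint_figure: "interior (square c) \<inter> figure S = {}"
proof -
  have False if "z \<in> interior (square c)" "z \<in> frontier (square d)" for z d
  proof -
    have "d = c" using that frontier_square_subset interior_square_unique by blast
    then show False using that by (simp add: frontier_def)
  qed
  then show ?thesis by (auto simp: figure_def)
qed

lemma interior_square_connected: "connected (interior (square c))" "interior (square c) \<noteq> {}"
proof -
  obtain x y where c: "c = (x, y)" by force
  show "connected (interior (square c))" unfolding c interior_square_eq by (intro connected_Times connected_Ioo)
  show "interior (square c) \<noteq> {}" unfolding c interior_square_eq by auto
qed

text \<open>Convexity makes the outer part connected, because the complement of a bounded convex set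
  in the plane is connected. This case suffices, since the only systems constructed below are rows
  of three squares.\<close>

lemma polyomino_components:
  assumes "finite S" "convex (\<Union>c\<in>S. square c)"
  shows "components (- figure S) = insert (- (\<Union>c\<in>S. square c)) ((\<lambda>c. interior (square c)) ` S)" (is "_ = insert ?O ?I")
proof (rule components_open_unique)
  have bd: "bounded (\<Union>c\<in>S. square c)" using assms(1) by (auto simp: square_def)
  show "pairwise disjnt (insert ?O ?I)"
  proof (intro pairwise_insert[THEN iffD2] conjI allI impI)
    show "pairwise disjnt ?I"
    proof (rule pairwise_imageI)
      fix c d assume "interior (square c) \<noteq> interior (square d)"
      then have "c \<noteq> d" by blast
      then show "disjnt (interior (square c)) (interior (square d))"
        unfolding disjnt_def using interior_square_unique interior_subset by blast
    qed
    have d: "disjnt (interior (square c)) ?O" if "c \<in> S" for c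
      unfolding disjnt_def using interior_subset that by blast
    show "disjnt ?O X" if "X \<in> ?I \<and> X \<noteq> ?O" for X using that d disjnt_sym by blast
    show "disjnt X ?O" if "X \<in> ?I \<and> X \<noteq> ?O" for X using that d by blast
  qed
  have "figure S \<subseteq> (\<Union>c\<in>S. square c)" unfolding figure_def using frontier_square_subset by blast
  moreover have "(\<Union>c\<in>S. square c) \<subseteq> figure S \<union> \<Union> ?I"
  proof
    fix z assume "z \<in> (\<Union>c\<in>S. square c)"
    then obtain c where "c \<in> S" "z \<in> square c" by blast
    with square_decomp[of c] show "z \<in> figure S \<union> \<Union> ?I" unfolding figure_def by blast
  qed
  moreover have "\<Union> ?I \<inter> figure S = {}"
  proof -
    have "interior (square c) \<inter> figure S = {}" for c by (rule interior_square_disjoint_figure)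
    then show ?thesis by blast
  qed
  moreover have "F \<subseteq> U \<Longrightarrow> U \<subseteq> F \<union> I \<Longrightarrow> I \<inter> F = {} \<Longrightarrow> - U \<union> I = - F" for F U I :: "(real \<times> real) set"
    by blast
  ultimately show "\<Union> (insert ?O ?I) = - figure S" by (simp only: Union_insert)
  have "?O \<noteq> {}" using bd by (metis Compl_eq_Diff_UNIV Diff_eq_empty_iff bounded_subset not_bounded_UNIV)
  moreover have "open ?O" using assms(1) closed_square by (intro open_Compl closed_UN) auto
  moreover have "connected ?O" using bd assms(2) by (intro connected_complement_bounded_convex) auto
  ultimately show "open X \<and> connected X \<and> X \<noteq> {}" if "X \<in> insert ?O ?I" for X
    using that interior_square_connected by auto
qed

lemma convex_polyomino_system:
  assumes "finite S" "S \<noteq> {}" "convex (\<Union>c\<in>S. square c)"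
    and "\<And>c d. c \<in> S \<Longrightarrow> d \<in> S \<Longrightarrow> (c, d) \<in> {(a, b). a \<in> S \<and> b \<in> S \<and> adjacent a b}\<^sup>*"
  shows "polyomino_system S"
proof -
  have "bounded (\<Union>c\<in>S. square c)" using assms(1) by (auto simp: square_def)
  then have O: "\<not> bounded (- (\<Union>c\<in>S. square c))"
    by (metis Compl_partition bounded_Un not_bounded_UNIV)
  have I: "bounded (interior (square c))" for c
    by (metis bounded_cbox bounded_interior square_def)
  have "{R \<in> components (- figure S). bounded R} = (\<lambda>c. interior (square c)) ` S"
    unfolding polyomino_components[OF assms(1,3)] using O I by auto
  moreover have "\<exists>!R. R \<in> components (- figure S) \<and> \<not> bounded R"
    unfolding polyomino_components[OF assms(1,3)] using O I by (intro ex1I[of _ "- (\<Union>c\<in>S. square c)"]) auto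
  ultimately show ?thesis using assms unfolding polyomino_system_def by blast
qed


text \<open>The unbounded component serves as \<open>R\<close>. The component around an open cell
  outside \<open>S\<close> is not bounded, because the bounded ones are the interiors of squares of
  \<open>S\<close>; by uniqueness it is \<open>R\<close>.\<close>

lemma polyomino_system_outer_region:
  assumes "polyomino_system S"
  obtains R where "connected R" "\<And>c. c \<in> S \<Longrightarrow> R \<inter> square c = {}" "\<And>a. a \<notin> S \<Longrightarrow> interior (square a) \<subseteq> R"
proof -
  have ex: "\<exists>!R. R \<in> components (- figure S) \<and> \<not> bounded R"
    and bd: "{C \<in> components (- figure S). bounded C} = (\<lambda>c. interior (square c)) ` S"
    using assms by (simp_all only: polyomino_system_def)
  obtain R where R: "R \<in> components (- figure S)" "\<not> bounded R" using ex by blast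
  have uniq: "C = R" if "C \<in> components (- figure S)" "\<not> bounded C" for C
    using ex R that by (metis (no_types, lifting))
  show ?thesis
  proof
    show "connected R" using R by (rule_tac in_components_connected)
    show "R \<inter> square c = {}" if c: "c \<in> S" for c
    proof -
      have "interior (square c) \<in> {C \<in> components (- figure S). bounded C}" unfolding bd using c by blast
      then have "R \<inter> interior (square c) = {}"
        using components_nonoverlap[OF R(1), of "interior (square c)"] R(2) by auto
      moreover have "R \<inter> frontier (square c) = {}"
        using in_components_subset[OF R(1)] c unfolding figure_def by blast
      ultimately show ?thesis using square_decomp[of c] by blast
    qed
    show "interior (square a) \<subseteq> R" if a: "a \<notin> S" for a
    proof -
      obtain C where C: "C \<in> components (- figure S)" "interior (square a) \<subseteq> C"
        using exists_component_superset[of "interior (square a)" "- figure S"]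
          interior_square_disjoint_figure[of a S] interior_square_connected[of a] by blast
      have "\<not> bounded C"
      proof
        assume "bounded C"
        then have "C \<in> (\<lambda>c. interior (square c)) ` S" using C(1) unfolding bd[symmetric] by blast
        then obtain c where c: "c \<in> S" "C = interior (square c)" by blast
        obtain z where z: "z \<in> interior (square a)" using interior_square_connected(2)[of a] by blast
        then have "z \<in> square c" using C(2) c(2) interior_subset by blast
        from interior_square_unique[OF z this] c(1) a show False by simp
      qed
      then show ?thesis using uniq[OF C(1)] C(2) by simp
    qed
  qed
qed

section \<open>Excluding contact at a corner only\<close>

definition center :: "cell \<Rightarrow> complex" where
  "center c = Complex (of_int (fst c) + 1 / 2) (of_int (snd c) + 1 / 2)"

text \<open>An arc in the middle lines of the squares keeps distance at least 1/2 from every corner, so near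
  a corner the loop it forms with a diagonal of two squares is just that diagonal.\<close>

definition midlines :: "cell set \<Rightarrow> complex set" where
  "midlines S = {z. (\<exists>c\<in>S. (Re z, Im z) \<in> square c) \<and> (\<exists>k::int. Re z = of_int k + 1 / 2 \<or> Im z = of_int k + 1 / 2)}"

lemma center_in_midlines: "c \<in> S \<Longrightarrow> center c \<in> midlines S"
  unfolding midlines_def
  by (intro CollectI conjI bexI[of _ c] exI[of _ "fst c"]) (cases c, auto simp: center_def square_eq)+

lemma closed_segment_centers:
  assumes "a \<in> S" "b \<in> S" "adjacent a b"
  shows "closed_segment (center a) (center b) \<subseteq> midlines S"
proof
  fix z assume "z \<in> closed_segment (center a) (center b)"
  then obtain u where u: "0 \<le> u" "u \<le> 1" "z = (1 - u) *\<^sub>R center a + u *\<^sub>R center b" by (auto simp: in_segment)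
  obtain x y x' y' where xy: "a = (x, y)" "b = (x', y')" by (metis surj_pair)
  have z: "Re z = x + 1 / 2 + u * (x' - x)" "Im z = y + 1 / 2 + u * (y' - y)"
    by (simp_all add: u(3) center_def xy algebra_simps)
  have cs: "x' = x + 1 \<and> y' = y \<or> x' = x - 1 \<and> y' = y \<or> x' = x \<and> y' = y + 1 \<or> x' = x \<and> y' = y - 1"
    using assms(3) unfolding xy adjacent_cases .
  have "Re z = of_int x + 1 / 2 \<or> Im z = of_int y + 1 / 2"
    using cs z by (elim disjE conjE) simp_all
  then have "\<exists>k::int. Re z = of_int k + 1 / 2 \<or> Im z = of_int k + 1 / 2" by blast
  moreover have "(Re z, Im z) \<in> square a \<or> (Re z, Im z) \<in> square b"
    using cs u unfolding xy square_eq mem_Times_iff fst_conv snd_conv z by (elim disjE conjE) auto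
  ultimately show "z \<in> midlines S" using assms unfolding midlines_def by blast
qed

lemma path_component_midlines:
  assumes "(a, b) \<in> {(a, b). a \<in> S \<and> b \<in> S \<and> adjacent a b}\<^sup>*" "a \<in> S"
  shows "path_component (midlines S) (center a) (center b)"
  using assms
proof (induction rule: rtrancl_induct)
  case base
  then show ?case by (intro path_component_refl center_in_midlines)
next
  case (step b d)
  then have "closed_segment (center b) (center d) \<subseteq> midlines S" by (intro closed_segment_centers) auto
  then have "path_component (midlines S) (center b) (center d)" by (rule path_component_linepath)
  then show ?case using step path_component_trans by blast
qed

text \<open>The common corner is \<open>p\<close>, \<open>w\<close> leads from it to the centre of
  \<open>d\<close>, and \<open>e\<close> selects the diagonal. Since \<open>\<i> * w\<close> is
  \<open>w\<close> turned by a right angle, \<open>a\<close> and \<open>b\<close> are the other two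
  cells at \<open>p\<close>. Both have their interior in the outer region, which thus reaches both
  sides of the loop through \<open>c\<close> and \<open>d\<close>.\<close>

lemma no_corner_contact_aux:
  fixes X Y :: int and e :: real
  assumes S: "polyomino_system S" and e: "e = 1 \<or> e = - 1"
    and cd: "c \<in> S" "d \<in> S" and ab: "a \<notin> S" "b \<notin> S"
    and pos: "center c = Complex X Y - Complex (1 / 2) (e / 2)" "center d = Complex X Y + Complex (1 / 2) (e / 2)"
      "center a = Complex X Y + \<i> * Complex (1 / 2) (e / 2)" "center b = Complex X Y - \<i> * Complex (1 / 2) (e / 2)"
  shows False
proof -
  define p w where "p = Complex X Y" and "w = Complex (1 / 2) (e / 2)"
  note pos = pos[folded p_def w_def]
  obtain R where R: "connected R" "\<And>c. c \<in> S \<Longrightarrow> R \<inter> square c = {}" "\<And>a. a \<notin> S \<Longrightarrow> interior (square a) \<subseteq> R"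
    using polyomino_system_outer_region[OF S] by blast
  define R' where "R' = (\<lambda>z. Complex (fst z) (snd z)) ` R"
  have "connected R'" unfolding R'_def
    by (intro connected_continuous_image R(1) continuous_on_Complex continuous_intros)
  have R'_iff: "z \<in> R' \<longleftrightarrow> (Re z, Im z) \<in> R" for z unfolding R'_def by (force simp: image_iff)
  have "path_component (midlines S) (p - w) (p + w)"
    using path_component_midlines[of c d S] S cd pos unfolding polyomino_system_def by auto
  then obtain g0 where g0: "path g0" "path_image g0 \<subseteq> midlines S" "pathstart g0 = p - w" "pathfinish g0 = p + w"
    unfolding path_component_def by blast
  have "p - w \<noteq> p + w" by (simp add: p_def w_def complex_eq_iff)
  then obtain g where g: "arc g" "path_image g \<subseteq> path_image g0" "pathstart g = p - w" "pathfinish g = p + w"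
    using path_contains_arc[OF g0(1,3,4)] by blast
  have gm: "path_image g \<subseteq> midlines S" using g(2) g0(2) by blast
  have seg: "\<exists>t. \<bar>t\<bar> \<le> 1 \<and> Re z = X + t / 2 \<and> Im z = Y + t * e / 2"
    if "z \<in> closed_segment (p - w) (p + w)" for z
  proof -
    obtain u where u: "0 \<le> u" "u \<le> 1" "z = (1 - u) *\<^sub>R (p - w) + u *\<^sub>R (p + w)"
      using \<open>z \<in> closed_segment (p - w) (p + w)\<close> by (auto simp: in_segment)
    have "Re z = X + (2 * u - 1) / 2" "Im z = Y + (2 * u - 1) * e / 2"
      unfolding u(3) by (simp_all add: p_def w_def field_simps)
    then show ?thesis using u by (intro exI[of _ "2 * u - 1"]) auto
  qed
  \<comment> \<open>On the diagonal, a half-integral coordinate makes the parameter \<open>t\<close>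
    an odd integer, so the arc can meet the diagonal only at its ends.\<close>
  have half: "t = 1 \<or> t = - 1" if "\<bar>t\<bar> \<le> 1" "real_of_int k + 1 / 2 = real_of_int X + t / 2" for t k X
  proof -
    have "t = real_of_int (2 * (k - X) + 1)" using that(2) by simp
    moreover from this that(1) have "\<bar>2 * (k - X) + 1\<bar> \<le> 1" by linarith
    then have "k - X \<le> 0" "- 1 \<le> k - X" by (auto simp: abs_le_iff)
    then have "k - X = 0 \<or> k - X = - 1" by linarith
    then have "2 * (k - X) + 1 = 1 \<or> 2 * (k - X) + 1 = - 1" by auto
    ultimately show ?thesis by (metis of_int_1 of_int_minus)
  qed
  show False
  \<comment> \<open>The radius is the distance that midlines keep from a corner. The second
    \<open>1 / 2\<close> selects the points halfway from \<open>p\<close> to the centres of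
    \<open>a\<close> and \<open>b\<close>, which are inside these cells.\<close>
  proof (rule crossing_separates[of g p w "1 / 2" R' "1 / 2"])
    show "path_image g \<inter> closed_segment (p - w) (p + w) \<subseteq> {p - w, p + w}"
    proof
      fix z assume z: "z \<in> path_image g \<inter> closed_segment (p - w) (p + w)"
      then obtain t where t: "\<bar>t\<bar> \<le> 1" "Re z = X + t / 2" "Im z = Y + t * e / 2" using seg by blast
      obtain k :: int where "Re z = of_int k + 1 / 2 \<or> Im z = of_int k + 1 / 2"
        using z gm unfolding midlines_def by blast
      then have "t = 1 \<or> t = - 1"
      proof
        assume "Re z = of_int k + 1 / 2"
        then show ?thesis using half[of t k X] t by simp
      next
        assume "Im z = of_int k + 1 / 2"
        then have "t * e = 1 \<or> t * e = - 1" using half[of "t * e" k Y] t e by auto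
        then show ?thesis using e by auto
      qed
      then show "z \<in> {p - w, p + w}" using t by (auto simp: p_def w_def complex_eq_iff)
    qed
    show "path_image g \<inter> ball p (1 / 2) = {}"
    proof -
      have False if z: "z \<in> midlines S" "dist p z < 1 / 2" for z
      proof -
        obtain k :: int where k: "Re z = of_int k + 1 / 2 \<or> Im z = of_int k + 1 / 2"
          using z unfolding midlines_def by blast
        have "\<bar>Re z - X\<bar> < 1 / 2" "\<bar>Im z - Y\<bar> < 1 / 2"
          using z(2) abs_Re_le_cmod[of "z - p"] abs_Im_le_cmod[of "z - p"]
          by (auto simp: dist_norm norm_minus_commute p_def)
        with k have "\<bar>real_of_int (2 * (k - X) + 1)\<bar> < 1 \<or> \<bar>real_of_int (2 * (k - Y) + 1)\<bar> < 1"
          by (auto simp: abs_if split: if_splits)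
        moreover have "1 \<le> \<bar>real_of_int (2 * i + 1)\<bar>" for i
        proof -
          have "2 * i + 1 \<noteq> 0" by (metis dvd_triv_left even_plus_one_iff even_zero)
          then have "1 \<le> \<bar>2 * i + 1\<bar>" by simp
          then show ?thesis by (metis of_int_1_le_iff of_int_abs)
        qed
        ultimately show False by (metis not_le)
      qed
      then show ?thesis using gm unfolding ball_def by blast
    qed
    have nw: "norm w = sqrt (1 / 2)" using e by (auto simp: w_def complex_norm power2_eq_square)
    show "1 / 2 \<le> norm w" using abs_Re_le_cmod[of w] by (simp add: w_def)
    have "norm w < 1" using nw by simp
    then show "1 / 2 * norm w < 1 / 2" by simp
    show "R' \<inter> path_image g = {}"
    proof -
      have False if "z \<in> R'" "z \<in> midlines S" for z
        using that R(2) unfolding R'_iff midlines_def by blast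
      then show ?thesis using gm by blast
    qed
    show "R' \<inter> closed_segment (p - w) (p + w) = {}"
    proof -
      have False if z: "z \<in> R'" "z \<in> closed_segment (p - w) (p + w)" for z
      proof -
        obtain t where t: "\<bar>t\<bar> \<le> 1" "Re z = X + t / 2" "Im z = Y + t * e / 2" using seg[OF z(2)] by blast
        have "(Re z, Im z) \<in> square c \<or> (Re z, Im z) \<in> square d"
          using t e pos(1,2) square_eq[of "fst c" "snd c"] square_eq[of "fst d" "snd d"]
          by (cases "t \<le> 0") (auto simp: center_def p_def w_def complex_eq_iff)
        then show False using z(1) R(2) cd unfolding R'_iff by blast
      qed
      then show ?thesis by blast
    qed
    show "p + complex_of_real (1 / 2) * (\<i> * w) \<in> R'"
    proof -
      have "(Re (p + complex_of_real (1 / 2) * (\<i> * w)), Im (p + complex_of_real (1 / 2) * (\<i> * w))) \<in> interior (square a)"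
        using e pos(3) interior_square_eq[of "fst a" "snd a"] by (auto simp: center_def p_def w_def complex_eq_iff)
      then show ?thesis using R(3)[OF ab(1)] unfolding R'_iff by blast
    qed
    show "p - complex_of_real (1 / 2) * (\<i> * w) \<in> R'"
    proof -
      have "(Re (p - complex_of_real (1 / 2) * (\<i> * w)), Im (p - complex_of_real (1 / 2) * (\<i> * w))) \<in> interior (square b)"
        using e pos(4) interior_square_eq[of "fst b" "snd b"] by (auto simp: center_def p_def w_def complex_eq_iff)
      then show ?thesis using R(3)[OF ab(2)] unfolding R'_iff by blast
    qed
  qed (use g \<open>connected R'\<close> in auto)
qed

text \<open>The cases are the orientations of the diagonal: \<open>c\<close> is always its left
  square, and \<open>e\<close> is \<open>1\<close> if it rises and \<open>- 1\<close> if it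
  falls.\<close>

lemma diagonal_cells_common_neighbour:
  assumes "polyomino_system S" "(x, y) \<in> S" "(x', y') \<in> S" "\<bar>x - x'\<bar> = 1" "\<bar>y - y'\<bar> = 1"
  shows "(x, y') \<in> S \<or> (x', y) \<in> S"
proof (rule ccontr)
  assume "\<not> ?thesis"
  then have ab: "(x, y') \<notin> S" "(x', y) \<notin> S" by blast+
  have "(x' = x + 1 \<or> x' = x - 1) \<and> (y' = y + 1 \<or> y' = y - 1)"
    using assms(4,5) by (auto simp: abs_if split: if_splits)
  then consider "x' = x + 1" "y' = y + 1" | "x' = x + 1" "y' = y - 1" | "x' = x - 1" "y' = y + 1" | "x' = x - 1" "y' = y - 1"
    by blast
  then show False
  proof cases
    case 1
    show ?thesis
      by (rule no_corner_contact_aux[where S = S and c = "(x, y)" and d = "(x', y')" and a = "(x, y')" and b = "(x', y)"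
            and X = "x + 1" and Y = "y + 1" and e = 1])
        (use assms ab 1 in \<open>auto simp: center_def complex_eq_iff\<close>)
  next
    case 2
    show ?thesis
      by (rule no_corner_contact_aux[where S = S and c = "(x, y)" and d = "(x', y')" and a = "(x', y)" and b = "(x, y')"
            and X = "x + 1" and Y = "y" and e = "- 1"])
        (use assms ab 2 in \<open>auto simp: center_def complex_eq_iff\<close>)
  next
    case 3
    show ?thesis
      by (rule no_corner_contact_aux[where S = S and c = "(x', y')" and d = "(x, y)" and a = "(x, y')" and b = "(x', y)"
            and X = "x" and Y = "y + 1" and e = "- 1"])
        (use assms ab 3 in \<open>auto simp: center_def complex_eq_iff\<close>)
  next
    case 4
    show ?thesis
      by (rule no_corner_contact_aux[where S = S and c = "(x', y')" and d = "(x, y)" and a = "(x', y)" and b = "(x, y')"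
            and X = "x" and Y = "y" and e = 1])
        (use assms ab 4 in \<open>auto simp: center_def complex_eq_iff\<close>)
  qed
qed

section \<open>Paths of cells\<close>

text \<open>Only combinatorial facts are kept; for a chain, the topology enters through
  \<open>touch\<close>. Thus three squares in a row can be treated as a path before they are known
  to form a polyomino system.\<close>

locale cell_path =
  fixes c :: "nat \<Rightarrow> cell" and n :: nat
  assumes inj: "inj_on c {..<n}"
    and adj: "\<lbrakk>i < n; j < n\<rbrakk> \<Longrightarrow> adjacent (c i) (c j) \<longleftrightarrow> i = Suc j \<or> j = Suc i"
    and touch: "\<lbrakk>i < n; j < n; corners (c i) \<inter> corners (c j) \<noteq> {}\<rbrakk> \<Longrightarrow> i \<le> j + 2"
begin

abbreviation cells :: "cell set" where "cells \<equiv> c ` {..<n}"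

text \<open>The path never steps back, as its squares are distinct, so unequal consecutive steps are
  perpendicular.\<close>

definition turn :: "nat \<Rightarrow> bool" where
  "turn i \<longleftrightarrow> 0 < i \<and> Suc i < n \<and> c (Suc i) - c i \<noteq> c i - c (i - 1)"

lemma c_eq: "\<lbrakk>i < n; j < n\<rbrakk> \<Longrightarrow> c i = c j \<longleftrightarrow> i = j"
  using inj by (auto simp: inj_on_def)

text \<open>By \<open>touch\<close>, squares that meet only at a corner are two steps apart, and the
  square between them in the path is adjacent to both.\<close>

lemma diag_common:
  assumes "(x, y) \<in> cells" "(x', y') \<in> cells" "\<bar>x - x'\<bar> = 1" "\<bar>y - y'\<bar> = 1"
  shows "(x, y') \<in> cells \<or> (x', y) \<in> cells"
proof -
  obtain i where i: "i < n" "c i = (x, y)" using assms(1) by auto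
  obtain j where j: "j < n" "c j = (x', y')" using assms(2) by auto
  note ij = i(1) j(1) i(2) j(2)
  have "corners (c i) \<inter> corners (c j) \<noteq> {}" using assms unfolding ij corners_meet_iff by simp
  then have le: "i \<le> j + 2" "j \<le> i + 2" using touch[of i j] touch[of j i] ij(1,2) by (simp_all add: Int_commute)
  have "\<not> adjacent (c i) (c j)" using assms unfolding ij adjacent_iff by simp
  then have ne: "i \<noteq> Suc j" "j \<noteq> Suc i" using adj[of i j] ij(1,2) by simp_all
  have "i \<noteq> j" using ij(3,4) assms(3) by auto
  note ne = ne this
  obtain k where k: "k < n" "k = Suc i \<or> i = Suc k" "k = Suc j \<or> j = Suc k"
  proof (cases "i < j")
    case True with le ne have "j = Suc (Suc i)" by linarith
    with ij(2) show ?thesis by (intro that[of "Suc i"]) auto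
  next
    case False with le ne have "i = Suc (Suc j)" by linarith
    with ij(1) show ?thesis by (intro that[of "Suc j"]) auto
  qed
  obtain a b where ab: "c k = (a, b)" by force
  have "adjacent (c i) (c k)" "adjacent (c j) (c k)"
    using adj[of i k] adj[of j k] k ij(1,2) by auto
  moreover have "(x' = x + 1 \<or> x' = x - 1) \<and> (y' = y + 1 \<or> y' = y - 1)"
    using assms(3,4) by (auto simp: abs_if split: if_splits)
  ultimately have "a = x \<and> b = y' \<or> a = x' \<and> b = y"
    unfolding ij ab adjacent_cases by (elim conjE disjE) simp_all
  moreover have "(a, b) \<in> cells" using k(1) ab by (metis imageI lessThan_iff)
  ultimately show ?thesis by auto
qed

text \<open>A block would be a cycle of length four in the adjacency relation, which is that of a
  path.\<close>

lemma no_block: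
  assumes "(x, y) \<in> cells" "(x + 1, y) \<in> cells" "(x, y + 1) \<in> cells" "(x + 1, y + 1) \<in> cells"
  shows False
proof -
  obtain i where i: "i < n" "c i = (x, y)" using assms(1) by auto
  obtain j where j: "j < n" "c j = (x + 1, y)" using assms(2) by auto
  obtain k where k: "k < n" "c k = (x, y + 1)" using assms(3) by auto
  obtain l where l: "l < n" "c l = (x + 1, y + 1)" using assms(4) by auto
  have "adjacent (c i) (c j)" "adjacent (c i) (c k)" "adjacent (c j) (c l)" "adjacent (c k) (c l)"
    unfolding i j k l adjacent_iff by simp_all
  then have "i = Suc j \<or> j = Suc i" "i = Suc k \<or> k = Suc i" "j = Suc l \<or> l = Suc j" "k = Suc l \<or> l = Suc k"
    using adj i(1) j(1) k(1) l(1) by blast+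
  moreover have "i \<noteq> l" "j \<noteq> k" using i j k l by auto
  ultimately show False by linarith
qed

text \<open>For a nonempty set of cells around \<open>v\<close> the formula fails only for all four
  cells and for two diagonal ones; these are excluded by \<open>no_block\<close> and
  \<open>diag_common\<close>.\<close>

lemma degree_cells:
  assumes "i < n" "v \<in> corners (c i)"
  shows "degree (graph_of cells) v = 1 + card {d \<in> cells. v \<in> corners d}"
proof -
  obtain x y where v: "v = (x, y)" by force
  obtain a b where ab: "c i = (a, b)" by force
  define C where "C = cells"
  have "(a, b) \<in> C" using assms ab[symmetric] by (auto simp: C_def)
  moreover have "(a = x \<or> a = x - 1) \<and> (b = y \<or> b = y - 1)" using assms unfolding v ab mem_corners by auto
  ultimately have "(x, y) \<in> C \<or> (x - 1, y) \<in> C \<or> (x, y - 1) \<in> C \<or> (x - 1, y - 1) \<in> C" by auto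
  moreover have "\<not> ((x - 1, y - 1) \<in> C \<and> (x, y - 1) \<in> C \<and> (x - 1, y) \<in> C \<and> (x, y) \<in> C)"
    using no_block[of "x-1" "y-1"] by (auto simp: C_def simp del: image_iff)
  moreover have "(x, y) \<in> C \<and> (x - 1, y - 1) \<in> C \<longrightarrow> (x - 1, y) \<in> C \<or> (x, y - 1) \<in> C"
    "(x - 1, y) \<in> C \<and> (x, y - 1) \<in> C \<longrightarrow> (x, y) \<in> C \<or> (x - 1, y - 1) \<in> C"
    unfolding C_def using diag_common[of x y "x-1" "y-1"] diag_common[of "x-1" y x "y-1"] by linarith+
  ultimately show ?thesis
    unfolding v degree_graph_of card_cells_at C_def[symmetric]
    by (cases "(x, y) \<in> C"; cases "(x - 1, y) \<in> C"; cases "(x, y - 1) \<in> C"; cases "(x - 1, y - 1) \<in> C") simp_all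
qed

lemma card_cells_index:
  "card {d \<in> cells. Q d} = (\<Sum>k<n. of_bool (Q (c k)))"
proof -
  have "{d \<in> cells. Q d} = c ` {k\<in>{..<n}. Q (c k)}" by auto
  moreover have "inj_on c {k\<in>{..<n}. Q (c k)}" using inj by (rule inj_on_subset) auto
  ultimately have "card {d \<in> cells. Q d} = card {k\<in>{..<n}. Q (c k)}" by (simp only: card_image)
  also have "{k\<in>{..<n}. Q (c k)} = {..<n} \<inter> {k. Q (c k)}" by auto
  finally show ?thesis by simp
qed

text \<open>Double counting: the weight of a side is split evenly among the squares that contain
  it.\<close>

lemma sum_connectivity_cells:
  "sum_connectivity \<alpha> (graph_of cells) =
    (\<Sum>i<n. \<Sum>e\<in>sides (c i). real (\<Sum>v\<in>e. degree (graph_of cells) v) powr \<alpha> / card {d \<in> cells. e \<in> sides d})"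
    (is "_ = (\<Sum>i<n. \<Sum>e\<in>sides (c i). ?w e / ?m e)")
proof -
  define C E where "C = cells" and "E = (\<Union>d\<in>C. sides d)"
  define w m where "w = (\<lambda>e. real (\<Sum>v\<in>e. degree (graph_of C) v) powr \<alpha>)"
    and "m = (\<lambda>e. card {d \<in> C. e \<in> sides d})"
  define W where "W = (\<lambda>e. w e / m e)"
  have fin: "finite C" "finite E" by (auto simp: C_def E_def finite_sides)
  have "(\<Sum>i<n. \<Sum>e\<in>sides (c i). W e) = (\<Sum>d\<in>C. \<Sum>e\<in>sides d. W e)"
    unfolding C_def by (rule sum.reindex[OF inj, unfolded o_def, symmetric])
  also have "\<dots> = (\<Sum>d\<in>C. \<Sum>e\<in>E. if e \<in> sides d then W e else 0)"
  proof (rule sum.cong[OF refl])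
    fix d assume "d \<in> C"
    then have "sides d \<subseteq> E" by (auto simp: E_def)
    then show "(\<Sum>e\<in>sides d. W e) = (\<Sum>e\<in>E. if e \<in> sides d then W e else 0)"
      using fin by (intro sum.mono_neutral_cong_left) auto
  qed
  also have "\<dots> = (\<Sum>e\<in>E. \<Sum>d\<in>C. if e \<in> sides d then W e else 0)"
    by (rule sum.swap)
  also have "\<dots> = (\<Sum>e\<in>E. w e)"
  proof (rule sum.cong[OF refl])
    fix e assume "e \<in> E"
    then have "{d \<in> C. e \<in> sides d} \<noteq> {}" unfolding E_def by blast
    moreover have "finite {d \<in> C. e \<in> sides d}" using fin(1) by (rule finite_subset[rotated]) blast
    ultimately have "m e \<noteq> 0" unfolding m_def by (simp only: card_eq_0_iff) blast
    have "(\<Sum>d\<in>C. if e \<in> sides d then W e else 0) = (\<Sum>d\<in>{d \<in> C. e \<in> sides d}. W e)"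
      by (rule sum.inter_filter[symmetric]) (rule fin)
    also have "\<dots> = m e * W e" by (simp add: m_def)
    also have "\<dots> = w e" using \<open>m e \<noteq> 0\<close> by (simp add: W_def)
    finally show "(\<Sum>d\<in>C. if e \<in> sides d then W e else 0) = w e" .
  qed
  finally show ?thesis
    by (simp only: W_def w_def m_def E_def C_def sum_connectivity_def graph_of_def snd_conv)
qed

end

section \<open>Local weights\<close>

text \<open>What a square contributes on behalf of one neighbour: half of their common side, the neighbour
  accounting for the other half, and one further side. The flags \<open>k\<close> and \<open>l\<close> say that the
  square and the neighbour are turns, \<open>q\<close> that the square has a corner of degree 2.\<close>

definition half_weight :: "(nat \<Rightarrow> real) \<Rightarrow> bool \<Rightarrow> bool \<Rightarrow> bool \<Rightarrow> real" where
  "half_weight p q k l = p (6 + of_bool k + of_bool l) / 2 + p ((if q then 5 else 6) + of_bool l)"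

text \<open>\<open>A\<close>, \<open>P\<close>, \<open>(x, y)\<close>, \<open>Q\<close>,
  \<open>B\<close> play the role of five consecutive squares. By \<open>disj\<close> and
  \<open>no_U\<close>, turns at \<open>P\<close> and at \<open>Q\<close> affect different outer
  sides of \<open>(x, y)\<close>, so each outer side can be charged to one neighbour.\<close>

lemma cell_weight:
  fixes x y :: int and A P Q B :: cell and D :: "point \<Rightarrow> nat" and m :: "point set \<Rightarrow> nat"
  assumes PQ: "adjacent (x, y) P" "adjacent (x, y) Q" "P \<noteq> Q"
    and AB: "adjacent P A" "adjacent Q B" "A \<noteq> (x, y)" "B \<noteq> (x, y)"
    and disj: "corners A \<inter> corners Q = {}" "corners P \<inter> corners B = {}"
    and no_U: "Q - (x, y) = (x, y) - P \<Longrightarrow> A - P = B - Q \<Longrightarrow> False"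
    and D: "\<And>v. v \<in> corners (x, y) \<Longrightarrow> D v = 2 + of_bool (v \<in> corners A) + of_bool (v \<in> corners P) +
       of_bool (v \<in> corners Q) + of_bool (v \<in> corners B)"
    and m: "\<And>e. e \<in> sides (x, y) \<Longrightarrow> m e = 1 + of_bool (e \<in> sides P) + of_bool (e \<in> sides Q)"
  shows "(\<Sum>e\<in>sides (x, y). p (\<Sum>v\<in>e. D v) / real (m e)) =
    half_weight p (Q - (x, y) \<noteq> (x, y) - P) (Q - (x, y) \<noteq> (x, y) - P) ((x, y) - P \<noteq> P - A) +
    half_weight p (Q - (x, y) \<noteq> (x, y) - P) (Q - (x, y) \<noteq> (x, y) - P) (B - Q \<noteq> Q - (x, y))"
proof -
  have disj': "\<not> (\<bar>fst A - fst Q\<bar> \<le> 1 \<and> \<bar>snd A - snd Q\<bar> \<le> 1)" "\<not> (\<bar>fst P - fst B\<bar> \<le> 1 \<and> \<bar>snd P - snd B\<bar> \<le> 1)"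
    using disj corners_meet_iff[of "fst A" "snd A" "fst Q" "snd Q"]
      corners_meet_iff[of "fst P" "snd P" "fst B" "snd B"]
    by simp_all
  have D': "D (x, y) = 2 + of_bool ((x, y) \<in> corners A) + of_bool ((x, y) \<in> corners P) +
       of_bool ((x, y) \<in> corners Q) + of_bool ((x, y) \<in> corners B)"
     "D (x+1, y) = 2 + of_bool ((x+1, y) \<in> corners A) + of_bool ((x+1, y) \<in> corners P) +
       of_bool ((x+1, y) \<in> corners Q) + of_bool ((x+1, y) \<in> corners B)"
     "D (x, y+1) = 2 + of_bool ((x, y+1) \<in> corners A) + of_bool ((x, y+1) \<in> corners P) +
       of_bool ((x, y+1) \<in> corners Q) + of_bool ((x, y+1) \<in> corners B)"
     "D (x+1, y+1) = 2 + of_bool ((x+1, y+1) \<in> corners A) + of_bool ((x+1, y+1) \<in> corners P) +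
       of_bool ((x+1, y+1) \<in> corners Q) + of_bool ((x+1, y+1) \<in> corners B)"
    by (simp_all add: D mem_corners)
  note Pc = PQ(1)[unfolded adjacent_offsets fst_conv snd_conv]
  note Qc = PQ(2)[unfolded adjacent_offsets fst_conv snd_conv]
  note Ac = AB(1)[unfolded adjacent_offsets]
  note Bc = AB(2)[unfolded adjacent_offsets]
  have m': "m {(x, y), (x + 1, y)} = 1 + of_bool (P = (x, y - 1)) + of_bool (Q = (x, y - 1))"
    "m {(x, y), (x, y + 1)} = 1 + of_bool (P = (x - 1, y)) + of_bool (Q = (x - 1, y))"
    "m {(x + 1, y), (x + 1, y + 1)} = 1 + of_bool (P = (x + 1, y)) + of_bool (Q = (x + 1, y))"
    "m {(x, y + 1), (x + 1, y + 1)} = 1 + of_bool (P = (x, y + 1)) + of_bool (Q = (x, y + 1))"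
    using Pc Qc by (elim disjE; simp add: m sides_def doubleton_eq_iff)+
  note s = sum_sides D' m' half_weight_def mem_corners
  have no_U': "\<not> (Q - (x, y) = (x, y) - P \<and> A - P = B - Q)" using no_U by blast
  \<comment> \<open>The step from \<open>(x, y)\<close> to \<open>P\<close> has one coordinate zero,
    so swapping its coordinates makes it perpendicular. Thus \<open>A\<close> goes straight on or
    bends to one of two sides.\<close>
  have Ac': "A = (2 * fst P - x, 2 * snd P - y) \<or> A = (fst P + (snd P - y), snd P + (fst P - x)) \<or>
      A = (fst P - (snd P - y), snd P - (fst P - x))"
    using Pc Ac AB(3) by (elim disjE; simp)
  have Bc': "B = (2 * fst Q - x, 2 * snd Q - y) \<or> B = (fst Q + (snd Q - y), snd Q + (fst Q - x)) \<or>
      B = (fst Q - (snd Q - y), snd Q - (fst Q - x))"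
    using Qc Bc AB(4) by (elim disjE; simp)
  have "?thesis" if "P = (x + 1, y)"
    using that Qc Ac' Bc' disj' no_U' PQ(3) by (elim disjE; simp add: s)
  moreover have "?thesis" if "P = (x - 1, y)"
    using that Qc Ac' Bc' disj' no_U' PQ(3) by (elim disjE; simp add: s)
  moreover have "?thesis" if "P = (x, y + 1)"
    using that Qc Ac' Bc' disj' no_U' PQ(3) by (elim disjE; simp add: s)
  moreover have "?thesis" if "P = (x, y - 1)"
    using that Qc Ac' Bc' disj' no_U' PQ(3) by (elim disjE; simp add: s)
  ultimately show ?thesis using Pc by (elim disjE)
qed

text \<open>The side away from the chain joins two vertices of degree 2 and gives
  \<open>p 4\<close>. Each lateral side gives \<open>p 5\<close>, except that a turn of
  \<open>Q\<close> raises one of them to \<open>p 6\<close>; that one is charged to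
  \<open>Q\<close>.\<close>

lemma end_cell_weight:
  fixes x y :: int and Q B :: cell and D :: "point \<Rightarrow> nat" and m :: "point set \<Rightarrow> nat"
  assumes Q: "adjacent (x, y) Q" and B: "adjacent Q B" "B \<noteq> (x, y)"
    and D: "\<And>v. v \<in> corners (x, y) \<Longrightarrow> D v = 2 + of_bool (v \<in> corners Q) + of_bool (v \<in> corners B)"
    and m: "\<And>e. e \<in> sides (x, y) \<Longrightarrow> m e = 1 + of_bool (e \<in> sides Q)"
  shows "(\<Sum>e\<in>sides (x, y). p (\<Sum>v\<in>e. D v) / real (m e)) =
    p 4 + p 5 + half_weight p True False (B - Q \<noteq> Q - (x, y))"
proof -
  have D': "D (x, y) = 2 + of_bool ((x, y) \<in> corners Q) + of_bool ((x, y) \<in> corners B)"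
     "D (x+1, y) = 2 + of_bool ((x+1, y) \<in> corners Q) + of_bool ((x+1, y) \<in> corners B)"
     "D (x, y+1) = 2 + of_bool ((x, y+1) \<in> corners Q) + of_bool ((x, y+1) \<in> corners B)"
     "D (x+1, y+1) = 2 + of_bool ((x+1, y+1) \<in> corners Q) + of_bool ((x+1, y+1) \<in> corners B)"
    by (simp_all add: D mem_corners)
  note Qc = Q[unfolded adjacent_offsets fst_conv snd_conv]
  note Bc = B(1)[unfolded adjacent_offsets]
  have m': "m {(x, y), (x + 1, y)} = 1 + of_bool (Q = (x, y - 1))"
    "m {(x, y), (x, y + 1)} = 1 + of_bool (Q = (x - 1, y))"
    "m {(x + 1, y), (x + 1, y + 1)} = 1 + of_bool (Q = (x + 1, y))"
    "m {(x, y + 1), (x + 1, y + 1)} = 1 + of_bool (Q = (x, y + 1))"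
    using Qc by (elim disjE; simp add: m sides_def doubleton_eq_iff)+
  have Bc': "B = (2 * fst Q - x, 2 * snd Q - y) \<or> B = (fst Q + (snd Q - y), snd Q + (fst Q - x)) \<or>
      B = (fst Q - (snd Q - y), snd Q - (fst Q - x))"
    using Qc Bc B(2) by (elim disjE; simp)
  show ?thesis
    using Qc Bc' by (elim disjE; simp add: sum_sides D' m' half_weight_def mem_corners)
qed

section \<open>Summing the local weights along a path\<close>

context cell_path
begin

lemma adj_Suc: "Suc i < n \<Longrightarrow> adjacent (c i) (c (Suc i))" "Suc i < n \<Longrightarrow> adjacent (c (Suc i)) (c i)"
  using adj[of i "Suc i"] adj[of "Suc i" i] by auto

lemma touch': "\<lbrakk>i < n; j < n; v \<in> corners (c i); v \<in> corners (c j)\<rbrakk> \<Longrightarrow> i \<le> j + 2"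
  using touch[of i j] by blast

text \<open>By \<open>touch\<close>, a corner of \<open>c i\<close> lies only on squares at most two
  steps away. The constant 2 is the 1 of \<open>degree_cells\<close> plus the square
  \<open>c i\<close> itself.\<close>

lemma degree_cell:
  assumes i: "i < n" and v: "v \<in> corners (c i)"
  shows "degree (graph_of cells) v = 2 + of_bool (2 \<le> i \<and> v \<in> corners (c (i - 2))) +
    of_bool (1 \<le> i \<and> v \<in> corners (c (i - 1))) + of_bool (i + 1 < n \<and> v \<in> corners (c (i + 1))) +
    of_bool (i + 2 < n \<and> v \<in> corners (c (i + 2)))"
proof -
  define b1 b2 b3 b4 where b: "b1 \<longleftrightarrow> 2 \<le> i \<and> v \<in> corners (c (i - 2))"
    "b2 \<longleftrightarrow> 1 \<le> i \<and> v \<in> corners (c (i - 1))" "b3 \<longleftrightarrow> i + 1 < n \<and> v \<in> corners (c (i + 1))"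
    "b4 \<longleftrightarrow> i + 2 < n \<and> v \<in> corners (c (i + 2))"
  have "k = i - 2 \<and> 2 \<le> i \<or> k = i - 1 \<and> 1 \<le> i \<or> k = i \<or> k = i + 1 \<or> k = i + 2"
    if "k < n" "v \<in> corners (c k)" for k
    using touch'[OF i that(1) v that(2)] touch'[OF that(1) i that(2) v] by linarith
  then have "k < n \<and> v \<in> corners (c k) \<longleftrightarrow> b1 \<and> k = i - 2 \<or> b2 \<and> k = i - 1 \<or> k = i \<or> b3 \<and> k = i + 1 \<or> b4 \<and> k = i + 2" for k
    unfolding b using i v by (metis less_imp_diff_less)
  then have eq: "{..<n} \<inter> {k. v \<in> corners (c k)} = {k. b1 \<and> k = i - 2} \<union> {k. b2 \<and> k = i - 1} \<union>
      {i} \<union> {k. b3 \<and> k = i + 1} \<union> {k. b4 \<and> k = i + 2}"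
    by blast
  have "card ({..<n} \<inter> {k. v \<in> corners (c k)}) = 1 + of_bool b1 + of_bool b2 + of_bool b3 + of_bool b4"
  proof -
    have "b1 \<longrightarrow> i - Suc 0 \<noteq> i - 2 \<and> i \<noteq> i - 2" "b2 \<longrightarrow> i \<noteq> i - Suc 0" using b(1,2) by auto
    then show ?thesis unfolding eq by (cases b1; cases b2; cases b3; cases b4) (simp_all add: card_insert_if, linarith+)
  qed
  then show ?thesis
    unfolding degree_cells[OF i v] card_cells_index b[symmetric] by simp
qed

lemma mult_cell:
  assumes i: "i < n" and e: "e \<in> sides (c i)"
  shows "card {d \<in> cells. e \<in> sides d} = 1 + of_bool (1 \<le> i \<and> e \<in> sides (c (i - 1))) +
    of_bool (i + 1 < n \<and> e \<in> sides (c (i + 1)))"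
proof -
  define b1 b2 where b: "b1 \<longleftrightarrow> 1 \<le> i \<and> e \<in> sides (c (i - 1))" "b2 \<longleftrightarrow> i + 1 < n \<and> e \<in> sides (c (i + 1))"
  have "k = i - 1 \<and> 1 \<le> i \<or> k = i \<or> k = i + 1" if "k < n" "e \<in> sides (c k)" for k
  proof (cases "k = i")
    case False
    then have "adjacent (c i) (c k)" using e that c_eq[OF i that(1)] unfolding adjacent_def by blast
    then show ?thesis using adj[OF i that(1)] by auto
  qed simp
  then have "k < n \<and> e \<in> sides (c k) \<longleftrightarrow> b1 \<and> k = i - 1 \<or> k = i \<or> b2 \<and> k = i + 1" for k
    unfolding b using i e by (metis less_imp_diff_less)
  then have eq: "{..<n} \<inter> {k. e \<in> sides (c k)} = {k. b1 \<and> k = i - 1} \<union> {i} \<union> {k. b2 \<and> k = i + 1}"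
    by blast
  have "card ({..<n} \<inter> {k. e \<in> sides (c k)}) = 1 + of_bool b1 + of_bool b2"
  proof -
    have "b1 \<longrightarrow> i \<noteq> i - Suc 0" using b(1) by auto
    then show ?thesis unfolding eq by (cases b1; cases b2) (simp_all add: card_insert_if)
  qed
  then show ?thesis
    unfolding card_cells_index b[symmetric] by simp
qed

definition end_cell :: "nat \<Rightarrow> bool" where "end_cell i \<longleftrightarrow> i = 0 \<or> Suc i = n"

text \<open>Equal outward steps at the two ends of a row cannot run along the row, because one of
  them would step back onto its middle square. So they are perpendicular to it, towards the same
  side.\<close>

definition no_U :: bool where
  "no_U \<longleftrightarrow> (\<forall>i. i + 4 < n \<longrightarrow> \<not> (c (i + 3) - c (i + 2) = c (i + 2) - c (i + 1) \<and> c i - c (i + 1) = c (i + 4) - c (i + 3)))"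

abbreviation W :: "(nat \<Rightarrow> real) \<Rightarrow> nat \<Rightarrow> bool \<Rightarrow> real" where
  "W p i l \<equiv> half_weight p (turn i \<or> end_cell i) (turn i) l"

abbreviation cell_sum :: "(nat \<Rightarrow> real) \<Rightarrow> nat \<Rightarrow> real" where
  "cell_sum p i \<equiv> (\<Sum>e\<in>sides (c i). p (\<Sum>v\<in>e. degree (graph_of cells) v) / card {d \<in> cells. e \<in> sides d})"

lemma corners_disj: "\<lbrakk>i < n; j < n; i + 2 < j\<rbrakk> \<Longrightarrow> corners (c i) \<inter> corners (c j) = {}"
  using touch[of j i] by (auto simp: Int_commute)

text \<open>Where \<open>c (i - 2)\<close> does not exist, its place is taken by the cell continuing straight on, which
  has no corner in common with \<open>c i\<close>.\<close>

lemma cell_sum_inner: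
  assumes i: "0 < i" "Suc i < n" and "no_U"
  shows "cell_sum p i = W p i (turn (i - 1)) + W p i (turn (Suc i))"
proof -
  obtain x y where xy: "c i = (x, y)" by force
  define P Q where "P = c (i - 1)" and "Q = c (Suc i)"
  define A B where "A = (if 2 \<le> i then c (i - 2) else P + (P - c i))"
    and "B = (if i + 2 < n then c (i + 2) else Q + (Q - c i))"
  have P: "adjacent (x, y) P" using adj_Suc(2)[of "i - 1"] i xy by (simp add: P_def)
  have Q: "adjacent (x, y) Q" using adj_Suc(1)[of i] i xy by (simp add: Q_def)
  have PQ: "P \<noteq> Q" unfolding P_def Q_def using c_eq[of "i - 1" "Suc i"] i by auto
  note Pc = P[unfolded adjacent_offsets fst_conv snd_conv]
  note Qc = Q[unfolded adjacent_offsets fst_conv snd_conv]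
  have A: "adjacent P A \<and> A \<noteq> (x, y)"
  proof (cases "2 \<le> i")
    case True
    then have "Suc (i - 2) = i - 1" by linarith
    then show ?thesis using adj_Suc(2)[of "i - 2"] c_eq[of "i - 2" i] i xy True by (simp add: P_def A_def)
  next
    case False
    then show ?thesis using Pc by (elim disjE; simp add: A_def xy adjacent_cases)
  qed
  have B: "adjacent Q B \<and> B \<noteq> (x, y)"
  proof (cases "i + 2 < n")
    case True
    then show ?thesis using adj_Suc(1)[of "Suc i"] c_eq[of "i + 2" i] i xy by (simp add: Q_def B_def)
  next
    case False
    then show ?thesis using Qc by (elim disjE; simp add: B_def xy adjacent_cases)
  qed
  have AQ: "corners A \<inter> corners Q = {}"
  proof (cases "2 \<le> i")
    case True
    then show ?thesis using corners_disj[of "i - 2" "Suc i"] i by (simp add: A_def Q_def)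
  next
    case False
    have "\<not> (corners (2 * fst P - x, 2 * snd P - y) \<inter> corners (fst Q, snd Q) \<noteq> {})"
      unfolding corners_meet_iff using Pc Qc PQ by (elim disjE; simp)
    moreover have "A = (2 * fst P - x, 2 * snd P - y)" using False xy by (simp add: A_def prod_eq_iff)
    ultimately show ?thesis by simp
  qed
  have PB: "corners P \<inter> corners B = {}"
  proof (cases "i + 2 < n")
    case True
    then show ?thesis using corners_disj[of "i - 1" "i + 2"] i by (simp add: P_def B_def)
  next
    case False
    have "\<not> (corners (fst P, snd P) \<inter> corners (2 * fst Q - x, 2 * snd Q - y) \<noteq> {})"
      unfolding corners_meet_iff using Pc Qc PQ by (elim disjE; simp)
    moreover have "B = (2 * fst Q - x, 2 * snd Q - y)" using False xy by (simp add: B_def prod_eq_iff)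
    ultimately show ?thesis by simp
  qed
  have U: False if eq: "Q - (x, y) = (x, y) - P" "A - P = B - Q"
  proof (cases "2 \<le> i \<and> i + 2 < n")
    case True
    then have "i - 2 + 4 < n" by linarith
    moreover have "i - 2 + 4 = i + 2" "i - 2 + 3 = Suc i" "i - 2 + 2 = i" "i - 2 + 1 = i - 1" using True by linarith+
    ultimately show False
      using \<open>no_U\<close>[unfolded no_U_def, rule_format, of "i - 2"] eq True xy by (simp add: P_def Q_def A_def B_def)
  next
    case False
    \<comment> \<open>If one of \<open>A\<close> and \<open>B\<close> is a substitute cell, the
      equations make the other one equal to \<open>c i\<close>.\<close>
    then show False using eq A B xy by (auto simp: A_def B_def algebra_simps prod_eq_iff split: if_splits)
  qed
  have D: "degree (graph_of cells) v = 2 + of_bool (v \<in> corners A) + of_bool (v \<in> corners P) +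
       of_bool (v \<in> corners Q) + of_bool (v \<in> corners B)" if v: "v \<in> corners (x, y)" for v
  proof -
    have "2 \<le> i \<and> v \<in> corners (c (i - 2)) \<longleftrightarrow> v \<in> corners A"
    proof (cases "2 \<le> i")
      case False
      have "\<not> (corners (x, y) \<inter> corners (2 * fst P - x, 2 * snd P - y) \<noteq> {})"
        unfolding corners_meet_iff using Pc by (elim disjE; simp)
      moreover have "A = (2 * fst P - x, 2 * snd P - y)" using False xy by (simp add: A_def prod_eq_iff)
      ultimately show ?thesis using False v by blast
    qed (simp add: A_def)
    moreover have "i + 2 < n \<and> v \<in> corners (c (i + 2)) \<longleftrightarrow> v \<in> corners B"
    proof (cases "i + 2 < n")
      case False
      have "\<not> (corners (x, y) \<inter> corners (2 * fst Q - x, 2 * snd Q - y) \<noteq> {})"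
        unfolding corners_meet_iff using Qc by (elim disjE; simp)
      moreover have "B = (2 * fst Q - x, 2 * snd Q - y)" using False xy by (simp add: B_def prod_eq_iff)
      ultimately show ?thesis using False v by blast
    qed (simp add: B_def)
    ultimately show ?thesis
      using degree_cell[of i v] i v xy by (simp add: P_def Q_def Suc_le_eq)
  qed
  have m: "card {d \<in> cells. e \<in> sides d} = 1 + of_bool (e \<in> sides P) + of_bool (e \<in> sides Q)"
    if "e \<in> sides (x, y)" for e
    using mult_cell[of i e] i that xy by (simp add: P_def Q_def Suc_le_eq)
  have t: "turn i \<longleftrightarrow> Q - (x, y) \<noteq> (x, y) - P" using i xy by (simp add: turn_def P_def Q_def)
  have tA: "turn (i - 1) \<longleftrightarrow> (x, y) - P \<noteq> P - A"
  proof (cases "2 \<le> i")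
    case True
    then have "Suc (i - 1) = i" "i - 1 - 1 = i - 2" by linarith+
    then show ?thesis using True i xy by (auto simp: turn_def P_def A_def)
  next
    case False
    then show ?thesis using i xy by (auto simp: turn_def A_def)
  qed
  have tB: "turn (Suc i) \<longleftrightarrow> B - Q \<noteq> Q - (x, y)"
    using i xy by (auto simp: turn_def Q_def B_def)
  have "\<not> end_cell i" using i by (simp add: end_cell_def)
  then show ?thesis
    using cell_weight[OF P Q PQ conjunct1[OF A] conjunct1[OF B] conjunct2[OF A] conjunct2[OF B] AQ PB U D m, of p]
    unfolding xy t tA tB by simp
qed

lemma cell_sum_end:
  assumes ends: "i < n" "k < n" "k = Suc i \<or> i = Suc k" "end_cell i" and n: "2 < n"
  shows "cell_sum p i = p 4 + p 5 + W p i (turn k)"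
proof -
  obtain x y where xy: "c i = (x, y)" by force
  define l where "l = (if k = Suc i then Suc k else k - 1)"
  have l: "l < n" "l = Suc k \<or> k = Suc l" "l \<noteq> i" "i = 0 \<and> k = 1 \<and> l = 2 \<or> Suc i = n \<and> i = Suc k \<and> k = Suc l"
    using ends n by (auto simp: l_def end_cell_def)
  define Q B where "Q = c k" and "B = c l"
  have Q: "adjacent (x, y) Q" using adj[of i k] ends xy by (auto simp: Q_def)
  have B: "adjacent Q B" unfolding Q_def B_def using adj[OF ends(2) l(1)] l(2) by blast
  have Bne: "B \<noteq> (x, y)" unfolding B_def xy[symmetric] using c_eq[OF l(1) ends(1)] l(3) by simp
  have D: "degree (graph_of cells) v = 2 + of_bool (v \<in> corners Q) + of_bool (v \<in> corners B)"
    if "v \<in> corners (x, y)" for v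
    using degree_cell[of i v] l(4) ends n that xy by (auto simp: Q_def B_def numeral_2_eq_2)
  have m: "card {d \<in> cells. e \<in> sides d} = 1 + of_bool (e \<in> sides Q)" if "e \<in> sides (x, y)" for e
    using mult_cell[of i e] l(4) ends n that xy by (auto simp: Q_def B_def)
  have t: "\<not> turn i" using ends by (auto simp: turn_def end_cell_def)
  have tk: "turn k \<longleftrightarrow> B - Q \<noteq> Q - (x, y)"
    using l(4) n xy by (auto simp: turn_def Q_def B_def numeral_2_eq_2 algebra_simps)
  show ?thesis
    using end_cell_weight[OF Q B Bne D m, of p] ends(4) t unfolding xy tk by simp
qed

text \<open>An inner square contributes one term per neighbour, an end square one term and
  \<open>p 4 + p 5\<close>. The terms are regrouped by the consecutive pair to which they
  belong.\<close>

lemma sum_connectivity_turns: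
  fixes \<alpha> :: real
  assumes "2 < n" "no_U"
  defines "p \<equiv> \<lambda>d::nat. real d powr \<alpha>"
  shows "sum_connectivity \<alpha> (graph_of cells) = 2 * (p 4 + p 5) +
    (\<Sum>j<n - 1. W p j (turn (Suc j)) + W p (Suc j) (turn j))"
proof -
  obtain m where m: "n = Suc (Suc m)" "0 < m" using assms(1) by (metis less_imp_Suc_add numeral_2_eq_2 add_Suc zero_less_Suc)
  have split: "(\<Sum>i<Suc (Suc m). f i) = f 0 + (\<Sum>i<m. f (Suc i)) + f (Suc m)" for f :: "nat \<Rightarrow> real"
    using sum.lessThan_Suc_shift[of f "Suc m"] by simp
  have "sum_connectivity \<alpha> (graph_of cells) = (\<Sum>i<n. cell_sum p i)"
    unfolding sum_connectivity_cells p_def ..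
  also have "\<dots> = cell_sum p 0 + (\<Sum>i<m. cell_sum p (Suc i)) + cell_sum p (Suc m)"
    using split[of "cell_sum p"] unfolding m(1) .
  also have "cell_sum p 0 = p 4 + p 5 + W p 0 (turn 1)"
    using assms(1) by (intro cell_sum_end) (simp_all add: end_cell_def)
  also have "cell_sum p (Suc m) = p 4 + p 5 + W p (Suc m) (turn m)"
  proof (rule cell_sum_end)
    show "end_cell (Suc m)" unfolding end_cell_def using m by simp
  qed (use m in simp_all)
  also have "(\<Sum>i<m. cell_sum p (Suc i)) = (\<Sum>i<m. W p (Suc i) (turn i) + W p (Suc i) (turn (Suc (Suc i))))"
  proof (rule sum.cong[OF refl])
    fix i assume "i \<in> {..<m}"
    then have "0 < Suc i" "Suc (Suc i) < n" using m by simp_all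
    from cell_sum_inner[OF this assms(2), of p]
    show "cell_sum p (Suc i) = W p (Suc i) (turn i) + W p (Suc i) (turn (Suc (Suc i)))"
      unfolding diff_Suc_1 .
  qed
  also have "p 4 + p 5 + W p 0 (turn 1) + (\<Sum>i<m. W p (Suc i) (turn i) + W p (Suc i) (turn (Suc (Suc i)))) +
      (p 4 + p 5 + W p (Suc m) (turn m)) =
    2 * (p 4 + p 5) + ((\<Sum>j<Suc m. W p j (turn (Suc j))) + (\<Sum>j<Suc m. W p (Suc j) (turn j)))"
    unfolding sum.lessThan_Suc_shift[of "\<lambda>j. W p j (turn (Suc j))"]
      sum.lessThan_Suc[of "\<lambda>j. W p (Suc j) (turn j)"] sum.distrib by simp
  also have "\<dots> = 2 * (p 4 + p 5) + (\<Sum>j<n - 1. W p j (turn (Suc j)) + W p (Suc j) (turn j))"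
    unfolding m(1) sum.distrib by simp
  finally show ?thesis .
qed

end

section \<open>Chains, kinks and segments\<close>

text \<open>For \<open>touch\<close>: squares with a common corner are equal, adjacent or diagonal,
  and in the last case their common neighbour in \<open>S\<close> is next to both in the
  enumeration.\<close>

lemma polyomino_chain_cell_path:
  assumes "polyomino_chain S"
  obtains c where "cell_path c (card S)" "S = c ` {..<card S}"
proof -
  from assms have sys: "polyomino_system S"
    and "\<exists>cs. distinct cs \<and> set cs = S \<and> (\<forall>i<length cs. \<forall>j<length cs.
           adjacent (cs ! i) (cs ! j) \<longleftrightarrow> i = Suc j \<or> j = Suc i)"
    by (simp_all add: polyomino_chain_def)
  then obtain cs where cs: "distinct cs" "set cs = S"
      "\<And>i j. \<lbrakk>i < length cs; j < length cs\<rbrakk> \<Longrightarrow> adjacent (cs ! i) (cs ! j) \<longleftrightarrow> i = Suc j \<or> j = Suc i"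
    by blast
  have n: "card S = length cs" using cs by (metis distinct_card)
  have S: "S = (!) cs ` {..<card S}" unfolding n unfolding cs(2)[symmetric] set_conv_nth by blast
  have "cell_path ((!) cs) (card S)"
  proof
    show "inj_on ((!) cs) {..<card S}" unfolding n using cs(1) by (auto simp: inj_on_def nth_eq_iff_index_eq)
    show adj: "adjacent (cs ! i) (cs ! j) \<longleftrightarrow> i = Suc j \<or> j = Suc i" if "i < card S" "j < card S" for i j
      using cs(3) that n by simp
    show "i \<le> j + 2" if ij: "i < card S" "j < card S" and meet: "corners (cs ! i) \<inter> corners (cs ! j) \<noteq> {}" for i j
    proof -
      obtain x y x' y' where xy: "cs ! i = (x, y)" "cs ! j = (x', y')" by (metis surj_pair)
      then have near: "\<bar>x - x'\<bar> \<le> 1" "\<bar>y - y'\<bar> \<le> 1" using meet corners_meet_iff by auto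
      have inS: "(x, y) \<in> S" "(x', y') \<in> S" using xy ij n cs(2) nth_mem by metis+
      show ?thesis
      proof (cases "\<bar>x - x'\<bar> = 1 \<and> \<bar>y - y'\<bar> = 1")
        case True
        then obtain a b where ab: "(a, b) \<in> S" "(a, b) = (x, y') \<or> (a, b) = (x', y)"
          using diagonal_cells_common_neighbour[OF sys inS] by blast
        then obtain k where k: "k < card S" "cs ! k = (a, b)" using n cs(2) by (metis in_set_conv_nth)
        have "adjacent (cs ! i) (cs ! k)" "adjacent (cs ! k) (cs ! j)"
          using ab(2) True unfolding xy k(2) adjacent_iff by auto
        then show ?thesis using adj[OF ij(1) k(1)] adj[OF k(1) ij(2)] by linarith
      next
        case False
        show ?thesis
        proof (cases "x = x' \<and> y = y'")
          case True
          then have "i = j" using xy ij n nth_eq_iff_index_eq[OF cs(1), of i j] by simp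
          then show ?thesis by simp
        next
          case neq: False
          have "\<bar>x - x'\<bar> + \<bar>y - y'\<bar> = 1" using near False neq by linarith
          then show ?thesis using adj[OF ij] unfolding xy adjacent_iff by linarith
        qed
      qed
    qed
  qed
  then show ?thesis using S that by blast
qed

context cell_path
begin

lemma card_neighbours:
  assumes "i < n"
  shows "card {d \<in> cells. adjacent (c i) d} = of_bool (1 \<le> i) + of_bool (Suc i < n)"
proof -
  have "{..<n} \<inter> {k. adjacent (c i) (c k)} = {k. 1 \<le> i \<and> k = i - 1} \<union> {k. Suc i < n \<and> k = Suc i}"
    using assms adj[OF assms] by auto
  then show ?thesis unfolding card_cells_index by (cases "1 \<le> i"; cases "Suc i < n") (simp_all add: card_insert_if)
qed

lemma terminal_iff: "i < n \<Longrightarrow> 2 \<le> n \<Longrightarrow> terminal cells (c i) \<longleftrightarrow> end_cell i"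
  unfolding terminal_def end_cell_def by (cases "1 \<le> i"; cases "Suc i < n") (simp_all add: card_neighbours)

lemma non_terminal_iff: "i < n \<Longrightarrow> non_terminal cells (c i) \<longleftrightarrow> 0 < i \<and> Suc i < n"
  unfolding non_terminal_def by (cases "1 \<le> i"; cases "Suc i < n") (simp_all add: card_neighbours)

text \<open>At a turn some corner lies on neither neighbour, hence on no square two steps away
  either, and has degree 2. The neighbours of a straight square cover all its corners.\<close>

lemma kink_iff_turn:
  assumes i: "i < n"
  shows "kink cells (c i) \<longleftrightarrow> turn i"
proof (cases "0 < i \<and> Suc i < n")
  case inner: True
  obtain x y where xy: "c i = (x, y)" by force
  define P Q where "P = c (i - 1)" and "Q = c (Suc i)"
  have P: "adjacent (x, y) P" using adj_Suc(2)[of "i - 1"] inner xy by (simp add: P_def)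
  have Q: "adjacent (x, y) Q" using adj_Suc(1)[of i] inner xy by (simp add: Q_def)
  have "i - 1 < n" "i - 1 \<noteq> Suc i" using inner by linarith+
  then have PQ: "P \<noteq> Q" unfolding P_def Q_def using c_eq[of "i - 1" "Suc i"] inner by blast
  note Pc = P[unfolded adjacent_offsets fst_conv snd_conv]
  note Qc = Q[unfolded adjacent_offsets fst_conv snd_conv]
  have deg: "degree (graph_of cells) v = 2 + of_bool (2 \<le> i \<and> v \<in> corners (c (i - 2))) +
    of_bool (v \<in> corners P) + of_bool (v \<in> corners Q) + of_bool (i + 2 < n \<and> v \<in> corners (c (i + 2)))"
    if "v \<in> corners (x, y)" for v
    using degree_cell[OF i, of v] that inner xy by (simp add: P_def Q_def Suc_le_eq)
  have t: "turn i \<longleftrightarrow> Q - (x, y) \<noteq> (x, y) - P" using inner xy by (simp add: turn_def P_def Q_def)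
  have far: "v \<notin> corners d" if "v \<in> corners (x, y)" "v \<notin> corners R" "adjacent R d" "adjacent (x, y) R" "d \<noteq> (x, y)" for v d R
  proof -
    obtain a b a' b' p q where eq: "R = (a, b)" "d = (a', b')" "v = (p, q)" by (metis surj_pair)
    show ?thesis using that unfolding eq adjacent_cases mem_corners by (elim disjE conjE; simp; linarith?)
  qed
  have kink: "kink cells (c i) \<longleftrightarrow> (\<exists>v\<in>corners (x, y). degree (graph_of cells) v = 2)"
    using inner non_terminal_iff[OF i] unfolding kink_def xy by blast
  show ?thesis
  proof
    assume "turn i"
    then have "\<exists>v\<in>corners (x, y). v \<notin> corners P \<and> v \<notin> corners Q"
      using Pc Qc PQ unfolding t
      by (elim disjE; simp add: corners_def)
    then obtain v where v: "v \<in> corners (x, y)" "v \<notin> corners P" "v \<notin> corners Q" by blast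
    have "\<not> (2 \<le> i \<and> v \<in> corners (c (i - 2)))"
    proof
      assume A: "2 \<le> i \<and> v \<in> corners (c (i - 2))"
      then have "Suc (i - 2) = i - 1" "i - 2 < n" "i - 1 < n" "i - 2 \<noteq> i" using i by linarith+
      then show False using far[OF v(1,2), of "c (i - 2)"] A P adj_Suc(2)[of "i - 2"] c_eq[of "i - 2" i] i inner xy
        by (simp add: P_def)
    qed
    moreover have "\<not> (i + 2 < n \<and> v \<in> corners (c (i + 2)))"
      using far[OF v(1,3), of "c (i + 2)"] Q adj_Suc(1)[of "Suc i"] c_eq[of "i + 2" i] i inner xy
      by (auto simp: Q_def)
    ultimately have "degree (graph_of cells) v = 2" using deg[OF v(1)] v(2,3) by simp
    then show "kink cells (c i)" unfolding kink using v(1) by blast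
  next
    assume "kink cells (c i)"
    then obtain v where v: "v \<in> corners (x, y)" "degree (graph_of cells) v = 2" unfolding kink by blast
    then have "v \<notin> corners P" "v \<notin> corners Q" using deg[OF v(1)] by (auto split: if_splits)
    then show "turn i" unfolding t using v(1) Pc Qc by (elim disjE) (auto simp: corners_def)
  qed
next
  case False
  then show ?thesis using i by (auto simp: kink_def non_terminal_iff turn_def)
qed


text \<open>Stated for squares instead of indices, because it is applied to a chain with an
  enumeration of its own, which may run in the opposite direction.\<close>

lemma kink_consecutive:
  assumes "d1 \<in> cells" "d2 \<in> cells" "d3 \<in> cells" "adjacent d1 d2" "adjacent d2 d3" "d1 \<noteq> d3" "d3 - d2 \<noteq> d2 - d1"
  shows "kink cells d2"
proof -
  obtain i where i: "i < n" "d1 = c i" using assms(1) by auto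
  obtain j where j: "j < n" "d2 = c j" using assms(2) by auto
  obtain k where k: "k < n" "d3 = c k" using assms(3) by auto
  have a: "j = Suc i \<or> i = Suc j" "j = Suc k \<or> k = Suc j"
    using assms(4,5) adj[OF i(1) j(1)] adj[OF j(1) k(1)] unfolding i j k by blast+
  moreover have "i \<noteq> k" using assms(6) i k by auto
  ultimately consider "j = Suc i" "k = Suc j" | "i = Suc j" "j = Suc k" by linarith
  then have "turn j"
  proof cases
    case 1
    then show ?thesis using assms(7) i j k by (simp add: turn_def)
  next
    case 2
    have "d1 - d2 \<noteq> d2 - d3" using assms(7) by (metis minus_diff_eq)
    with 2 show ?thesis using i j k by (simp add: turn_def)
  qed
  then show ?thesis using kink_iff_turn[OF j(1)] j(2) by simp
qed

end

section \<open>Straight rows and U-turns as segments\<close>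

lemma convex_row:
  assumes "adjacent (x, y) P" "Q - (x, y) = (x, y) - P"
  shows "convex (\<Union>c\<in>{P, (x, y), Q}. square c)"
proof -
  have Q: "Q = (2 * x - fst P, 2 * y - snd P)" using assms(2) by (auto simp: prod_eq_iff)
  have "P = (x + 1, y) \<or> P = (x - 1, y) \<or> P = (x, y + 1) \<or> P = (x, y - 1)"
    using assms(1) unfolding adjacent_offsets by simp
  moreover have "(\<Union>c\<in>{P, (x, y), Q}. square c) = {real_of_int x - 1..x + 2} \<times> {real_of_int y..y + 1}"
    if "P = (x + 1, y) \<or> P = (x - 1, y)"
    using that unfolding Q by (elim disjE) (auto simp: square_eq)
  moreover have "(\<Union>c\<in>{P, (x, y), Q}. square c) = {real_of_int x..x + 1} \<times> {real_of_int y - 1..y + 2}"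
    if "P = (x, y + 1) \<or> P = (x, y - 1)"
    using that unfolding Q by (elim disjE) (auto simp: square_eq)
  moreover have "convex ({a..b} \<times> {a'..b'})" for a b a' b' :: real by (intro convex_Times convex_real_interval)
  ultimately show ?thesis by metis
qed

text \<open>A segment has to be a chain in its own right, so the conditions on regions must be
  checked for the row too; its convexity settles them.\<close>

lemma row_linear_chain:
  assumes c: "cell_path c 3" and "c 2 - c 1 = c 1 - c 0"
  shows "linear_chain (c ` {..<3})"
proof -
  interpret cell_path c 3 by fact
  obtain x y where xy: "c 1 = (x, y)" by force
  have img: "c ` {..<3} = {c 0, (x, y), c 2}"
    using xy by (auto simp: numeral_3_eq_3 lessThan_Suc numeral_2_eq_2)
  have A: "adjacent (c i) (c j)" if "i < 3" "j < 3" "i = Suc j \<or> j = Suc i" for i j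
    using adj that by blast
  let ?r = "{(a, b). a \<in> c ` {..<3} \<and> b \<in> c ` {..<3} \<and> adjacent a b}"
  have step: "(c i, c j) \<in> ?r" if "i < 3" "j < 3" "i = Suc j \<or> j = Suc i" for i j
    using that A by auto
  have to1: "(c i, c 1) \<in> ?r\<^sup>* \<and> (c 1, c i) \<in> ?r\<^sup>*" if "i < 3" for i
  proof -
    have "i = 0 \<or> i = 1 \<or> i = 2" using that by linarith
    then show ?thesis using step[of i 1] step[of 1 i] by (elim disjE) auto
  qed
  have sys: "polyomino_system (c ` {..<3})"
  proof (rule convex_polyomino_system)
    show "convex (\<Union>d\<in>c ` {..<3}. square d)"
      unfolding img using convex_row[of x y "c 0" "c 2"] A[of 1 0] assms(2) xy by simp
    show "(d, e) \<in> ?r\<^sup>*" if "d \<in> c ` {..<3}" "e \<in> c ` {..<3}" for d e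
    proof -
      obtain i j where "i < 3" "j < 3" "d = c i" "e = c j" using \<open>d \<in> c ` {..<3}\<close> \<open>e \<in> c ` {..<3}\<close> by blast
      then show ?thesis using rtrancl_trans[OF conjunct1[OF to1[of i]] conjunct2[OF to1[of j]]] by simp
    qed
    show "c ` {..<3} \<noteq> {}" unfolding img by blast
  qed simp
  have "card {e \<in> c ` {..<3}. adjacent d e} \<le> 2" if d: "d \<in> c ` {..<3}" for d
  proof -
    obtain i where "i < 3" "d = c i" using d by blast
    then show ?thesis using card_neighbours[of i] by simp
  qed
  moreover have "distinct (map c [0..<3]) \<and> set (map c [0..<3]) = c ` {..<3} \<and>
      (\<forall>i<length (map c [0..<3]). \<forall>j<length (map c [0..<3]).
        adjacent (map c [0..<3] ! i) (map c [0..<3] ! j) \<longleftrightarrow> i = Suc j \<or> j = Suc i)"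
    using inj adj by (simp add: distinct_map atLeast0LessThan del: upt_conv_Cons)
  ultimately have "polyomino_chain (c ` {..<3})" using sys unfolding polyomino_chain_def by blast
  moreover have "\<not> kink (c ` {..<3}) (c i)" if "i < 3" for i
  proof -
    have "\<not> turn i"
    proof
      assume t: "turn i"
      then have "i = 1" by (auto simp: turn_def)
      with t assms(2) show False by (simp add: turn_def numeral_2_eq_2)
    qed
    then show ?thesis using kink_iff_turn[OF that] by simp
  qed
  ultimately show ?thesis unfolding linear_chain_def by blast
qed

lemma rtrancl_leaves:
  assumes "(a, b) \<in> r\<^sup>*" "a \<in> T" "b \<notin> T"
  obtains u v where "(u, v) \<in> r" "u \<in> T" "v \<notin> T"
proof -
  have "b \<in> T \<or> (\<exists>u v. (u, v) \<in> r \<and> u \<in> T \<and> v \<notin> T)"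
    using assms(1,2) by (induction rule: rtrancl_induct) auto
  then show ?thesis using assms(3) that by blast
qed

text \<open>The point is maximality: a larger chain \<open>T'\<close> is connected, so it contains a
  neighbour of the row, \<open>c i\<close> or \<open>c (i + 4)\<close>. Then an end of the row is a
  kink of \<open>T'\<close>.\<close>

lemma (in cell_path) U_turn_internal_segment:
  assumes i: "i + 4 < n" and U: "c (i + 3) - c (i + 2) = c (i + 2) - c (i + 1)" "c i - c (i + 1) = c (i + 4) - c (i + 3)"
  shows "internal_segment cells {c (i + 1), c (i + 2), c (i + 3)}"
proof -
  define c1 where "c1 = (\<lambda>k. c (i + 1 + k))"
  define T where "T = c1 ` {..<3}"
  have T: "T = {c (i + 1), c (i + 2), c (i + 3)}"
    by (auto simp: T_def c1_def numeral_3_eq_3 lessThan_Suc)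
  have path: "cell_path c1 3"
  proof
    show "inj_on c1 {..<3}" using i by (auto simp: inj_on_def c1_def c_eq)
    show "adjacent (c1 j) (c1 k) \<longleftrightarrow> j = Suc k \<or> k = Suc j" if "j < 3" "k < 3" for j k
      using adj[of "i + 1 + j" "i + 1 + k"] that i by (simp add: c1_def)
    show "j \<le> k + 2" if "j < 3" for j k :: nat using that by linarith
  qed
  have "c1 2 - c1 1 = c1 1 - c1 0" using U by (simp add: c1_def numeral_eq_Suc)
  then have lin: "linear_chain T" unfolding T_def by (rule row_linear_chain[OF path])
  have ne: "c i \<noteq> c (i + 2)" "c (i + 4) \<noteq> c (i + 2)" using i by (simp_all add: c_eq)
  have ne': "c (i + 2) - c (i + 1) \<noteq> c (i + 1) - c i" "c (i + 2) - c (i + 3) \<noteq> c (i + 3) - c (i + 4)"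
    using U ne by (auto simp: prod_eq_iff)
  have sub: "T \<subseteq> cells" using i by (auto simp: T)
  have "T' = T" if T': "T \<subseteq> T'" "T' \<subseteq> cells" "linear_chain T'" for T'
  proof (rule ccontr)
    assume "T' \<noteq> T"
    then obtain z where z: "z \<in> T'" "z \<notin> T" using T' by blast
    have chain: "polyomino_chain T'" using T'(3) by (simp add: linear_chain_def)
    then obtain c' where c': "cell_path c' (card T')" "T' = c' ` {..<card T'}" by (rule polyomino_chain_cell_path)
    interpret T': cell_path c' "card T'" by fact
    let ?r = "{(a, b). a \<in> T' \<and> b \<in> T' \<and> adjacent a b}"
    have mid: "c (i + 2) \<in> T" by (simp add: T)
    have "\<forall>d\<in>T'. \<forall>e\<in>T'. (d, e) \<in> ?r\<^sup>*"
      using chain unfolding polyomino_chain_def polyomino_system_def by (elim conjE)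
    then have reach: "(c (i + 2), z) \<in> ?r\<^sup>*" using z(1) T'(1) mid by (simp only: subset_eq)
    obtain u v where uv: "(u, v) \<in> ?r" "u \<in> T" "v \<notin> T" by (rule rtrancl_leaves[OF reach mid z(2)])
    then obtain l where l: "l < n" "v = c l" using T'(2) by blast
    obtain k where k: "k = i + 1 \<or> k = i + 2 \<or> k = i + 3" "u = c k" using uv(2) unfolding T by blast
    have "k = Suc l \<or> l = Suc k" using adj[of k l] uv(1) l k i by auto
    moreover have "l \<noteq> i + 1" "l \<noteq> i + 2" "l \<noteq> i + 3" using uv(3) l unfolding T by auto
    ultimately have "l = i \<or> l = i + 4" using k(1) by linarith
    moreover have "v \<in> T'" using uv(1) by blast
    ultimately have "c i \<in> T' \<or> c (i + 4) \<in> T'" using l by auto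
    moreover have inT': "c (i + 1) \<in> T'" "c (i + 2) \<in> T'" "c (i + 3) \<in> T'" using T'(1) by (auto simp: T)
    ultimately have "kink T' (c (i + 1)) \<or> kink T' (c (i + 3))"
    proof (elim disjE)
      assume "c i \<in> T'"
      then have "kink T' (c (i + 1))"
        using T'.kink_consecutive[of "c i" "c (i + 1)" "c (i + 2)", folded c'(2)] inT' ne ne' adj i by simp
      then show ?thesis ..
    next
      assume "c (i + 4) \<in> T'"
      then have "kink T' (c (i + 3))"
        using T'.kink_consecutive[of "c (i + 4)" "c (i + 3)" "c (i + 2)", folded c'(2)] inT' ne ne' adj i by simp
      then show ?thesis ..
    qed
    then show False using T'(3) inT' unfolding linear_chain_def by blast
  qed
  then have seg: "segment cells T" using sub lin unfolding segment_def by blast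
  have "\<not> terminal cells d" if d: "d \<in> T" for d
  proof -
    obtain k where k: "k = i + 1 \<or> k = i + 2 \<or> k = i + 3" "d = c k" using d unfolding T by blast
    then have "0 < k" "Suc k < n" using i by linarith+
    then show ?thesis using terminal_iff[of k] k(2) by (simp add: end_cell_def)
  qed
  then have "internal_segment cells T" using seg unfolding internal_segment_def external_segment_def by blast
  then show ?thesis unfolding T .
qed

text \<open>In a U-turn both outer corners of the middle square lie on exactly two squares, so the outer side
  of that square joins two vertices of degree 3.\<close>

lemma U_turn_outer_side:
  assumes "adjacent (x, y) P" "adjacent P A" "A \<noteq> (x, y)" "B \<noteq> (x, y)"
    and Q: "Q = (2 * x - fst P, 2 * y - snd P)" and B: "B = (fst Q + (fst A - fst P), snd Q + (snd A - snd P))"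
  shows "\<exists>e\<in>sides (x, y). \<forall>v\<in>e. v \<in> corners (x, y) \<and> (v \<in> corners P \<longleftrightarrow> v \<notin> corners Q) \<and>
    v \<notin> corners A \<and> v \<notin> corners B"
proof -
  have "P = (x + 1, y) \<and> (A = (x + 1, y + 1) \<or> A = (x + 1, y - 1)) \<or>
    P = (x - 1, y) \<and> (A = (x - 1, y + 1) \<or> A = (x - 1, y - 1)) \<or>
    P = (x, y + 1) \<and> (A = (x + 1, y + 1) \<or> A = (x - 1, y + 1)) \<or>
    P = (x, y - 1) \<and> (A = (x + 1, y - 1) \<or> A = (x - 1, y - 1))"
    using assms(1-4) unfolding B Q adjacent_offsets by (elim disjE; simp)
  then show ?thesis unfolding B Q by (elim disjE conjE; simp add: sides_def mem_corners)
qed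

text \<open>The row of a U-turn would be an internal segment of the kind that \<open>Omega\<close>
  forbids, the outer side of its middle square being the edge in question.\<close>

lemma (in cell_path) Omega_no_U:
  assumes "cells \<in> Omega m"
  shows "no_U"
  unfolding no_U_def
proof (intro allI impI notI)
  fix i
  assume i: "i + 4 < n" and U: "c (i + 3) - c (i + 2) = c (i + 2) - c (i + 1) \<and> c i - c (i + 1) = c (i + 4) - c (i + 3)"
  define T where "T = {c (i + 1), c (i + 2), c (i + 3)}"
  have int: "internal_segment cells T" unfolding T_def using U_turn_internal_segment[OF i] U by blast
  have card: "card T = 3" unfolding T_def using i by (simp add: c_eq card_insert_if)
  obtain x y where xy: "c (i + 2) = (x, y)" by force
  define P Q A B where "P = c (i + 1)" and "Q = c (i + 3)" and "A = c i" and "B = c (i + 4)"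
  note defs = P_def Q_def A_def B_def
  have PA: "adjacent (x, y) P" "adjacent P A" using adj_Suc(2)[of "i + 1"] adj_Suc(2)[of i] i xy by (simp_all add: defs)
  have ne: "A \<noteq> (x, y)" "B \<noteq> (x, y)" using i by (simp_all add: defs c_eq flip: xy)
  have QB: "Q = (2 * x - fst P, 2 * y - snd P)" "B = (fst Q + (fst A - fst P), snd Q + (snd A - snd P))"
    using U xy by (auto simp: defs prod_eq_iff)
  obtain e where e: "e \<in> sides (x, y)"
    "\<And>v. v \<in> e \<Longrightarrow> v \<in> corners (x, y) \<and> (v \<in> corners P \<longleftrightarrow> v \<notin> corners Q) \<and> v \<notin> corners A \<and> v \<notin> corners B"
    using U_turn_outer_side[OF PA ne QB] by blast
  have "degree (graph_of cells) v = 3" if "v \<in> e" for v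
  proof -
    have "v \<in> corners (c (i + 2))" using e(2)[OF that] xy by simp
    from degree_cell[OF _ this] show ?thesis using i e(2)[OF that] by (auto simp: defs numeral_eq_Suc)
  qed
  moreover have "e \<in> snd (graph_of T)" using e(1) xy by (auto simp: graph_of_def T_def)
  ultimately show False using assms int card unfolding Omega_def by blast
qed

section \<open>Comparison of pair weights\<close>

lemma exp_gt_add_one:
  fixes x :: real
  assumes "x \<noteq> 0"
  shows "1 + x < exp x"
proof (cases "0 \<le> 1 + x / 2")
  case True
  have "1 + x < (1 + x / 2) * (1 + x / 2)"
    using assms by (auto simp: algebra_simps zero_less_mult_iff)
  also have "\<dots> \<le> exp (x / 2) * exp (x / 2)" using True by (intro mult_mono exp_ge_add_one_self) auto
  also have "\<dots> = exp x" by (simp flip: exp_add)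
  finally show ?thesis .
next
  case False
  then have "1 + x < 0" by simp
  then show ?thesis using exp_gt_zero[of x] by linarith
qed

text \<open>As a function of the exponent, the power is strictly convex, so at \<open>t\<close> it
  lies strictly below its chord over the unit interval. The proof averages the tangent bounds of
  \<open>exp\<close> at 0 and 1 with weights \<open>1 - t\<close> and \<open>t\<close>.\<close>

lemma powr_less_affine:
  fixes y t :: real
  assumes "0 < y" "y \<noteq> 1" "0 < t" "t < 1"
  shows "y powr t < 1 + t * (y - 1)"
proof -
  define a where "a = ln y"
  have a: "a \<noteq> 0" "y = exp a" using assms by (auto simp: a_def)
  have "1 - t * a < exp (- (t * a))" "1 + (1 - t) * a < exp ((1 - t) * a)"
    using exp_gt_add_one[of "- (t * a)"] exp_gt_add_one[of "(1 - t) * a"] a(1) assms by auto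
  then have "(1 - t) * (1 - t * a) + t * (1 + (1 - t) * a) < (1 - t) * exp (- (t * a)) + t * exp ((1 - t) * a)"
    using assms by (intro add_strict_mono mult_strict_left_mono) auto
  then have "1 < (1 - t) * exp (- (t * a)) + t * exp ((1 - t) * a)" by (simp add: algebra_simps)
  then have "exp (t * a) * 1 < exp (t * a) * ((1 - t) * exp (- (t * a)) + t * exp ((1 - t) * a))" by (intro mult_strict_left_mono) auto
  also have "\<dots> = (1 - t) + t * exp a"
    by (simp add: algebra_simps flip: exp_add)
  finally show ?thesis using a(2) by (simp add: powr_def algebra_simps)
qed

text \<open>After division by \<open>6 powr x\<close> the equation of \<open>x0\<close> reads \<open>(5/6) powr x + 2 * (7/6) powr x = 3\<close>;
  the left-hand side is strictly convex and takes the value 3 at 0 and at \<open>x0\<close>.\<close>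

lemma five_seven_less_six:
  fixes x0 \<alpha> :: real
  assumes "2 * 5 powr x0 - 6 powr (x0 + 1) + 4 * 7 powr x0 = 0" "x0 < \<alpha>" "\<alpha> < 0"
  shows "5 powr \<alpha> + 2 * 7 powr \<alpha> < 3 * 6 powr \<alpha>"
proof -
  define t where "t = \<alpha> / x0"
  have t: "0 < t" "t < 1" "\<alpha> = x0 * t" using assms(2,3) by (auto simp: t_def field_simps)
  define u v where "u = (5 / 6) powr x0" and "v = (7 / 6) powr x0"
  have "u \<noteq> 1" "v \<noteq> 1" "0 < u" "0 < v" using assms(2,3) by (auto simp: u_def v_def powr_eq_one_iff_gen)
  then have "u powr t < 1 + t * (u - 1)" "v powr t < 1 + t * (v - 1)"
    using t by (auto intro: powr_less_affine)
  moreover have "5 powr x0 = 6 powr x0 * u" "7 powr x0 = 6 powr x0 * v"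
    by (simp_all add: u_def v_def flip: powr_mult)
  with assms(1) have "6 powr x0 * (2 * u - 6 + 4 * v) = 0"
    by (simp add: powr_add algebra_simps)
  then have "u + 2 * v - 3 = 0" by simp
  then have "1 + t * (u - 1) + 2 * (1 + t * (v - 1)) = 3" by algebra
  moreover have "a' < a \<Longrightarrow> b' < b \<Longrightarrow> a + 2 * b = 3 \<Longrightarrow> a' + 2 * b' < 3" for a b a' b' :: real
    by linarith
  ultimately have "u powr t + 2 * v powr t < 3" by blast
  moreover have "5 powr \<alpha> = 6 powr \<alpha> * u powr t" "7 powr \<alpha> = 6 powr \<alpha> * v powr t"
    by (simp_all add: u_def v_def t(3) powr_powr flip: powr_mult)
  moreover have "6 powr \<alpha> * (u powr t + 2 * v powr t) < 6 powr \<alpha> * 3 \<longleftrightarrow> u powr t + 2 * v powr t < 3"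
    by (rule mult_less_cancel_left_pos) simp
  ultimately show ?thesis by (simp add: algebra_simps)
qed

text \<open>Midpoint convexity, obtained from 35 < 36 and the inequality between arithmetic and
  geometric means.\<close>

lemma two_six_less_five_seven:
  fixes \<alpha> :: real
  assumes "\<alpha> < 0"
  shows "2 * 6 powr \<alpha> < 5 powr \<alpha> + 7 powr \<alpha>"
proof -
  define a b c :: real where "a = 5 powr (\<alpha> / 2)" and "b = 7 powr (\<alpha> / 2)" and "c = 6 powr \<alpha>"
  have "c = 36 powr (\<alpha> / 2)" using powr_powr[of 6 2 "\<alpha> / 2"] by (simp add: c_def)
  also have "\<dots> < 35 powr (\<alpha> / 2)" using assms by (intro powr_less_mono2_neg) auto
  also have "\<dots> = a * b" by (simp add: a_def b_def flip: powr_mult)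
  finally have "2 * c < 2 * (a * b)" by simp
  also have "\<dots> \<le> a * a + b * b" using zero_le_square[of "a - b"] by (simp add: algebra_simps)
  also have "\<dots> = 5 powr \<alpha> + 7 powr \<alpha>" by (simp add: a_def b_def flip: powr_add)
  finally show ?thesis by (simp add: c_def)
qed

text \<open>The flags \<open>e\<close> and \<open>e'\<close> mark end squares of the path,
  \<open>k\<close> and \<open>l\<close> mark turns.\<close>

definition pair_weight :: "(nat \<Rightarrow> real) \<Rightarrow> bool \<Rightarrow> bool \<Rightarrow> bool \<Rightarrow> bool \<Rightarrow> real" where
  "pair_weight p e e' k l = half_weight p (k \<or> e) k l + half_weight p (l \<or> e') l k"

text \<open>For inner pairs, one turn outweighs two because the difference is
  \<open>(p 5 + p 7 - 2 * p 6) + (p 7 - p 8)\<close>. A pair with an end square weighs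
  \<open>p 5 + 2 * p 6\<close>, or \<open>p 5 + p 6 + p 7\<close> if its other square turns. End
  squares cannot turn, hence the minimiser \<open>\<not> e\<close>,
  \<open>\<not> e'\<close>.\<close>

lemma pair_weight_bounds:
  assumes p: "p 5 + 2 * p 7 < 3 * p 6" "2 * p 6 < p 5 + p 7" "p 6 < p 5" "p 7 < p 6" "p 8 < p 7"
    and ends: "\<not> (e \<and> k)" "\<not> (e' \<and> l)" "\<not> (e \<and> e')"
  shows "pair_weight p e e' k l \<le> pair_weight p e e' False False"
    and "pair_weight p e e' k l = pair_weight p e e' False False \<longleftrightarrow> \<not> k \<and> \<not> l"
    and "pair_weight p e e' (\<not> e) (\<not> e') \<le> pair_weight p e e' k l"
    and "pair_weight p e e' (\<not> e) (\<not> e') = pair_weight p e e' k l \<longleftrightarrow> k = (\<not> e) \<and> l = (\<not> e')"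
  using p ends
  by (cases e; cases e'; cases k; cases l; simp add: pair_weight_def half_weight_def; linarith?)+

lemma sum_eq_iff_of_le:
  fixes f g :: "'a \<Rightarrow> real"
  assumes "finite A" "\<And>i. i \<in> A \<Longrightarrow> f i \<le> g i"
  shows "sum f A = sum g A \<longleftrightarrow> (\<forall>i\<in>A. f i = g i)"
  using assms sum_strict_mono_ex1[of A f g] by (metis less_irrefl order_le_less sum.cong)

text \<open>Depends on \<open>\<alpha>\<close> and \<open>n\<close> only, like
  \<open>zigzag_value\<close>, so that a chain is compared with numbers; the equality criteria show
  later that \<open>L\<close> and \<open>Z\<close> attain them.\<close>

definition linear_value :: "real \<Rightarrow> nat \<Rightarrow> real" where
  "linear_value \<alpha> n = 2 * (4 powr \<alpha> + 5 powr \<alpha>) +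
    (\<Sum>j<n - 1. pair_weight (\<lambda>d. real d powr \<alpha>) (j = 0) (Suc (Suc j) = n) False False)"

definition zigzag_value :: "real \<Rightarrow> nat \<Rightarrow> real" where
  "zigzag_value \<alpha> n = 2 * (4 powr \<alpha> + 5 powr \<alpha>) +
    (\<Sum>j<n - 1. pair_weight (\<lambda>d. real d powr \<alpha>) (j = 0) (Suc (Suc j) = n) (j \<noteq> 0) (Suc (Suc j) \<noteq> n))"

lemma (in cell_path) sum_connectivity_bounds:
  fixes x0 \<alpha> :: real
  assumes root: "2 * 5 powr x0 - 6 powr (x0 + 1) + 4 * 7 powr x0 = 0" and \<alpha>: "x0 < \<alpha>" "\<alpha> < 0"
    and n: "2 < n" and U: "no_U"
  shows "sum_connectivity \<alpha> (graph_of cells) \<le> linear_value \<alpha> n"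
    and "sum_connectivity \<alpha> (graph_of cells) = linear_value \<alpha> n \<longleftrightarrow> (\<forall>i<n. \<not> turn i)"
    and "zigzag_value \<alpha> n \<le> sum_connectivity \<alpha> (graph_of cells)"
    and "zigzag_value \<alpha> n = sum_connectivity \<alpha> (graph_of cells) \<longleftrightarrow> (\<forall>i<n. turn i \<or> end_cell i)"
proof -
  define p where "p = (\<lambda>d::nat. real d powr \<alpha>)"
  have "p 5 + 2 * p 7 < 3 * p 6" "2 * p 6 < p 5 + p 7" "p 6 < p 5" "p 7 < p 6" "p 8 < p 7"
    using five_seven_less_six[OF root \<alpha>] two_six_less_five_seven[OF \<alpha>(2)] \<alpha>(2)
    by (auto simp: p_def intro!: powr_less_mono2_neg)
  note bounds = pair_weight_bounds[of p, OF this]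
  have t: "\<not> ((j = 0) \<and> turn j)" "\<not> (Suc (Suc j) = n \<and> turn (Suc j))" "\<not> (j = 0 \<and> Suc (Suc j) = n)" for j
    using n by (auto simp: turn_def)
  have e: "end_cell j \<longleftrightarrow> j = 0" "end_cell (Suc j) \<longleftrightarrow> Suc (Suc j) = n" if "j < n - 1" for j
    using that by (auto simp: end_cell_def)
  let ?B = "\<lambda>j. pair_weight p (j = 0) (Suc (Suc j) = n) (turn j) (turn (Suc j))"
  let ?L = "\<lambda>j. pair_weight p (j = 0) (Suc (Suc j) = n) False False"
  let ?Z = "\<lambda>j. pair_weight p (j = 0) (Suc (Suc j) = n) (j \<noteq> 0) (Suc (Suc j) \<noteq> n)"
  have B: "sum_connectivity \<alpha> (graph_of cells) = 2 * (4 powr \<alpha> + 5 powr \<alpha>) + (\<Sum>j<n - 1. ?B j)"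
    unfolding sum_connectivity_turns[OF n U] pair_weight_def
    by (auto simp: p_def e intro!: sum.cong)
  \<comment> \<open>Every index below \<open>n\<close> occurs in a consecutive pair, so equality in
    all pairs decides every square.\<close>
  have pairs: "(\<forall>j\<in>{..<n - 1}. Q j \<and> Q (Suc j)) \<longleftrightarrow> (\<forall>i<n. Q i)" for Q
  proof (intro iffI allI impI)
    fix i assume "\<forall>j\<in>{..<n - 1}. Q j \<and> Q (Suc j)" "i < n"
    then show "Q i" using n by (cases i) auto
  qed auto
  note L = linear_value_def[of \<alpha> n, folded p_def] and Z = zigzag_value_def[of \<alpha> n, folded p_def]
  show "sum_connectivity \<alpha> (graph_of cells) \<le> linear_value \<alpha> n"
    unfolding B L using bounds(1)[OF t] by (intro add_left_mono sum_mono)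
  show "zigzag_value \<alpha> n \<le> sum_connectivity \<alpha> (graph_of cells)"
    unfolding B Z using bounds(3)[OF t] by (intro add_left_mono sum_mono)
  have "sum_connectivity \<alpha> (graph_of cells) = linear_value \<alpha> n \<longleftrightarrow> (\<forall>j\<in>{..<n - 1}. ?B j = ?L j)"
    unfolding B L add_left_cancel by (rule sum_eq_iff_of_le) (use bounds(1)[OF t] in simp_all)
  also have "\<dots> \<longleftrightarrow> (\<forall>i<n. \<not> turn i)"
    unfolding bounds(2)[OF t] by (rule pairs)
  finally show "sum_connectivity \<alpha> (graph_of cells) = linear_value \<alpha> n \<longleftrightarrow> (\<forall>i<n. \<not> turn i)" .
  have "zigzag_value \<alpha> n = sum_connectivity \<alpha> (graph_of cells) \<longleftrightarrow> (\<forall>j\<in>{..<n - 1}. ?Z j = ?B j)"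
    unfolding B Z add_left_cancel by (rule sum_eq_iff_of_le) (use bounds(3)[OF t] in simp_all)
  also have "\<dots> \<longleftrightarrow> (\<forall>j\<in>{..<n - 1}. (turn j \<or> end_cell j) \<and> (turn (Suc j) \<or> end_cell (Suc j)))"
    unfolding bounds(4)[OF t] using t e by (intro ball_cong refl) auto
  also have "\<dots> \<longleftrightarrow> (\<forall>i<n. turn i \<or> end_cell i)" by (rule pairs)
  finally show "zigzag_value \<alpha> n = sum_connectivity \<alpha> (graph_of cells) \<longleftrightarrow> (\<forall>i<n. turn i \<or> end_cell i)" .
qed

section \<open>Graph isomorphisms\<close>

lemma graph_iso_sym: "graph_iso G H \<Longrightarrow> graph_iso H G"
proof -
  assume "graph_iso G H"
  then obtain f where f: "bij_betw f (fst G) (fst H)"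
    "\<And>u v. u \<in> fst G \<Longrightarrow> v \<in> fst G \<Longrightarrow> {u, v} \<in> snd G \<longleftrightarrow> {f u, f v} \<in> snd H"
    unfolding graph_iso_def by blast
  define g where "g = inv_into (fst G) f"
  have g: "bij_betw g (fst H) (fst G)" unfolding g_def by (rule bij_betw_inv_into[OF f(1)])
  have "{u, v} \<in> snd H \<longleftrightarrow> {g u, g v} \<in> snd G" if "u \<in> fst H" "v \<in> fst H" for u v
    using f(2)[of "g u" "g v"] that bij_betwE[OF g] bij_betw_inv_into_right[OF f(1)] by (simp add: g_def)
  with g show "graph_iso H G" unfolding graph_iso_def by blast
qed

lemma graph_iso_trans: "graph_iso G H \<Longrightarrow> graph_iso H K \<Longrightarrow> graph_iso G K"
proof -
  assume "graph_iso G H" "graph_iso H K"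
  then obtain f g where fg: "bij_betw f (fst G) (fst H)" "bij_betw g (fst H) (fst K)"
    "\<And>u v. u \<in> fst G \<Longrightarrow> v \<in> fst G \<Longrightarrow> {u, v} \<in> snd G \<longleftrightarrow> {f u, f v} \<in> snd H"
    "\<And>u v. u \<in> fst H \<Longrightarrow> v \<in> fst H \<Longrightarrow> {u, v} \<in> snd H \<longleftrightarrow> {g u, g v} \<in> snd K"
    unfolding graph_iso_def by blast
  have "{u, v} \<in> snd G \<longleftrightarrow> {(g \<circ> f) u, (g \<circ> f) v} \<in> snd K" if "u \<in> fst G" "v \<in> fst G" for u v
    using fg(3)[OF that] fg(4)[of "f u" "f v"] bij_betwE[OF fg(1)] that by simp
  with bij_betw_trans[OF fg(1,2)] show "graph_iso G K" unfolding graph_iso_def by blast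
qed

lemma graph_of_edge:
  assumes "e \<in> snd (graph_of S)"
  obtains u v where "e = {u, v}" "u \<in> fst (graph_of S)" "v \<in> fst (graph_of S)"
proof -
  obtain x y where xy: "(x, y) \<in> S" "e \<in> sides (x, y)" using assms by (auto simp: graph_of_def)
  have sub: "corners (x, y) \<subseteq> fst (graph_of S)" using xy(1) by (auto simp: graph_of_def)
  have "\<exists>u v. e = {u, v} \<and> u \<in> corners (x, y) \<and> v \<in> corners (x, y)"
    using xy(2) unfolding sides_def corners_def by auto
  then show ?thesis using that sub by blast
qed

text \<open>\<open>graph_iso\<close> only compares pairs of vertices; every edge of a polyomino
  graph is such a pair.\<close>

lemma graph_iso_edges:
  assumes "bij_betw f (fst (graph_of S)) (fst (graph_of T))"
    and "\<And>u v. u \<in> fst (graph_of S) \<Longrightarrow> v \<in> fst (graph_of S) \<Longrightarrow>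
      {u, v} \<in> snd (graph_of S) \<longleftrightarrow> {f u, f v} \<in> snd (graph_of T)"
  shows "snd (graph_of T) = (`) f ` snd (graph_of S)"
proof (intro set_eqI iffI)
  fix e assume "e \<in> (`) f ` snd (graph_of S)"
  then obtain e' where e': "e' \<in> snd (graph_of S)" "e = f ` e'" by blast
  then obtain u v where "e' = {u, v}" "u \<in> fst (graph_of S)" "v \<in> fst (graph_of S)" by (rule_tac graph_of_edge)
  then show "e \<in> snd (graph_of T)" using assms(2)[of u v] e' by simp
next
  fix e assume e: "e \<in> snd (graph_of T)"
  then obtain u v where uv: "e = {u, v}" "u \<in> fst (graph_of T)" "v \<in> fst (graph_of T)" by (rule graph_of_edge)
  obtain u' v' where "u = f u'" "v = f v'" "u' \<in> fst (graph_of S)" "v' \<in> fst (graph_of S)"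
    using uv(2,3) bij_betw_imp_surj_on[OF assms(1)] by blast
  then show "e \<in> (`) f ` snd (graph_of S)" using assms(2)[of u' v'] e uv(1) by (intro image_eqI[of _ _ "{u', v'}"]) auto
qed

lemma sum_connectivity_iso:
  assumes "graph_iso (graph_of S) (graph_of T)"
  shows "sum_connectivity \<alpha> (graph_of S) = sum_connectivity \<alpha> (graph_of T)"
proof -
  obtain f where f: "bij_betw f (fst (graph_of S)) (fst (graph_of T))"
    "\<And>u v. u \<in> fst (graph_of S) \<Longrightarrow> v \<in> fst (graph_of S) \<Longrightarrow>
      {u, v} \<in> snd (graph_of S) \<longleftrightarrow> {f u, f v} \<in> snd (graph_of T)"
    using assms unfolding graph_iso_def by blast
  define V E where "V = fst (graph_of S)" and "E = snd (graph_of S)"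
  have ET: "snd (graph_of T) = (`) f ` E" unfolding E_def by (rule graph_iso_edges[OF f])
  have inj: "inj_on f V" using f(1) unfolding V_def by (rule bij_betw_imp_inj_on)
  have EV: "e \<subseteq> V" if "e \<in> E" for e using graph_of_edge[of e S] that unfolding E_def V_def by blast
  have injE: "inj_on ((`) f) E" by (rule inj_on_subset[OF inj_on_image_Pow[OF inj]]) (use EV in blast)
  have deg: "degree (graph_of T) (f u) = degree (graph_of S) u" if u: "u \<in> V" for u
  proof -
    have "{e \<in> (`) f ` E. f u \<in> e} = (`) f ` {e \<in> E. u \<in> e}"
    proof -
      have "f u \<in> f ` e \<longleftrightarrow> u \<in> e" if "e \<in> E" for e
        by (rule inj_on_image_mem_iff[OF inj u EV[OF that]])
      then show ?thesis by blast
    qed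
    moreover have "inj_on ((`) f) {e \<in> E. u \<in> e}" using injE by (rule inj_on_subset) blast
    ultimately show ?thesis unfolding degree_def ET E_def[symmetric] by (simp only: card_image)
  qed
  have "(\<Sum>v\<in>f ` e. degree (graph_of T) v) = (\<Sum>v\<in>e. degree (graph_of S) v)" if "e \<in> E" for e
    using sum.reindex[OF inj_on_subset[OF inj EV[OF that]], of "degree (graph_of T)"] EV[OF that] deg
    by (auto simp: subset_eq intro!: sum.cong)
  then show ?thesis
    unfolding sum_connectivity_def ET E_def[symmetric] sum.reindex[OF injE] o_def
    by (intro sum.cong refl) simp
qed

text \<open>For perpendicular unit vectors \<open>d\<close>, \<open>d'\<close> this map of cells is induced by a symmetry of the grid of
  points. As a cell is named by its lower left corner, the map of points needs an extra translation.\<close>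

definition place :: "cell \<Rightarrow> cell \<Rightarrow> cell \<Rightarrow> cell \<Rightarrow> cell" where
  "place c0 d d' u = (fst c0 + fst u * fst d + snd u * fst d', snd c0 + fst u * snd d + snd u * snd d')"

lemma graph_iso_place:
  assumes "adjacent (0, 0) d" "adjacent (0, 0) d'" "d' \<noteq> d" "d' \<noteq> - d"
  shows "graph_iso (graph_of S) (graph_of (place c0 d d' ` S))"
proof -
  \<comment> \<open>Exactly one of \<open>d\<close> and \<open>d'\<close> is horizontal. If it
    points left, the lower left corner of a cell must go to the lower right corner of the image
    cell, one unit beyond the point that names it; likewise vertically.\<close>
  define t :: point where "t = (if fst d + fst d' = - 1 then 1 else 0, if snd d + snd d' = - 1 then 1 else 0)"
  define f :: "point \<Rightarrow> point" where "f u = (fst (place c0 d d' u) + fst t, snd (place c0 d d' u) + snd t)" for u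
  have cases: "d = (1, 0) \<and> (d' = (0, 1) \<or> d' = (0, - 1)) \<or> d = (- 1, 0) \<and> (d' = (0, 1) \<or> d' = (0, - 1)) \<or>
    d = (0, 1) \<and> (d' = (1, 0) \<or> d' = (- 1, 0)) \<or> d = (0, - 1) \<and> (d' = (1, 0) \<or> d' = (- 1, 0))"
    using assms unfolding adjacent_offsets by (elim disjE; simp)
  have inj: "inj f"
    using cases by (elim disjE conjE) (auto simp: inj_def f_def place_def)
  have corners: "corners (place c0 d d' u) = f ` corners u" for u
    using cases by (cases u, elim disjE conjE) (auto simp: corners_def f_def place_def t_def)
  have sides: "sides (place c0 d d' u) = (`) f ` sides u" for u
    using cases by (cases u, elim disjE conjE) (simp_all add: sides_def f_def place_def t_def algebra_simps insert_commute)
  have V: "fst (graph_of (place c0 d d' ` S)) = f ` fst (graph_of S)"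
    by (simp add: graph_of_def corners image_UN)
  have E: "snd (graph_of (place c0 d d' ` S)) = (`) f ` snd (graph_of S)"
    by (simp add: graph_of_def sides image_UN)
  have "{u, v} \<in> snd (graph_of S) \<longleftrightarrow> {f u, f v} \<in> snd (graph_of (place c0 d d' ` S))" for u v
  proof -
    have "{f u, f v} = f ` {u, v}" by simp
    moreover have "f ` {u, v} \<in> (`) f ` X \<longleftrightarrow> {u, v} \<in> X" for X
      unfolding image_iff inj_image_eq_iff[OF inj] by blast
    ultimately show ?thesis unfolding E by simp
  qed
  moreover have "bij_betw f (fst (graph_of S)) (fst (graph_of (place c0 d d' ` S)))"
    unfolding V bij_betw_def using inj_on_subset[OF inj] by blast
  ultimately show ?thesis unfolding graph_iso_def by blast
qed

section \<open>Normal forms of straight and zigzag paths\<close>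

context cell_path
begin

lemma unit_step: "Suc i < n \<Longrightarrow> adjacent (0, 0) (c (Suc i) - c i)"
  using adj_Suc(1)[of i] by (cases "c i"; cases "c (Suc i)") (auto simp: adjacent_cases)

lemma straight_iso:
  assumes "2 \<le> n" "\<forall>i<n. \<not> turn i"
  shows "graph_iso (graph_of ((\<lambda>i. (int i, 0)) ` {..<n})) (graph_of cells)"
proof -
  define d where "d = c 1 - c 0"
  have d: "adjacent (0, 0) d" using unit_step[of 0] assms(1) by (simp add: d_def)
  \<comment> \<open>Any perpendicular unit vector would do, since the model row has second
    coordinate 0.\<close>
  define d' where "d' = (- snd d, fst d)"
  have step: "c (Suc i) - c i = d" if "Suc i < n" for i
    using that
  proof (induction i)
    case (Suc i)
    then show ?case using assms(2)[rule_format, of "Suc i"] by (simp add: turn_def)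
  qed (simp add: d_def)
  have pos: "c i = place (c 0) d d' (int i, 0)" if "i < n" for i
    using that
  proof (induction i)
    case (Suc i)
    then have "c (Suc i) = c i + d" using step[of i] by (simp add: algebra_simps)
    with Suc show ?case by (simp add: place_def prod_eq_iff algebra_simps)
  qed (simp add: place_def)
  have eq: "cells = place (c 0) d d' ` (\<lambda>i. (int i, 0)) ` {..<n}"
    unfolding image_image by (rule image_cong[OF refl], rule pos, simp)
  have "adjacent (0, 0) d'" "d' \<noteq> d" "d' \<noteq> - d"
    using d unfolding adjacent_offsets by (auto simp: d'_def)
  then show ?thesis by (subst eq) (rule graph_iso_place[OF d])
qed

text \<open>Each turn could bend to two sides, but a step opposite to the last but one would make
  \<open>c i\<close> and \<open>c (i + 3)\<close> adjacent. So two perpendicular steps alternate, as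
  in the model staircase.\<close>

lemma zigzag_iso:
  assumes "2 < n" "\<forall>i<n. turn i \<or> end_cell i"
  shows "graph_iso (graph_of ((\<lambda>i. (int ((i + 1) div 2), int (i div 2))) ` {..<n})) (graph_of cells)"
proof -
  define d d' where "d = c 1 - c 0" and "d' = c 2 - c 1"
  have d: "adjacent (0, 0) d" "adjacent (0, 0) d'"
    using unit_step[of 0] unit_step[of 1] assms(1) by (simp_all add: d_def d'_def numeral_2_eq_2)
  have opp: "c (Suc (Suc i)) - c (Suc i) \<noteq> - (c (Suc i) - c i)" if "Suc (Suc i) < n" for i
    using c_eq[of "Suc (Suc i)" i] that by auto
  have turned: "c (Suc (Suc i)) - c (Suc i) \<noteq> c (Suc i) - c i" if "Suc (Suc i) < n" for i
    using assms(2)[rule_format, of "Suc i"] that by (auto simp: turn_def end_cell_def)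
  have perp: "d' \<noteq> d" "d' \<noteq> - d"
    using opp[of 0] turned[of 0] assms(1) by (simp_all add: d_def d'_def numeral_2_eq_2)
  have alternate: "c (Suc (Suc (Suc i))) - c (Suc (Suc i)) = c (Suc i) - c i" if i: "Suc (Suc (Suc i)) < n" for i
  proof -
    have "\<not> adjacent (c i) (c (Suc (Suc (Suc i))))" using adj[of i "Suc (Suc (Suc i))"] i by simp
    moreover have "c (Suc (Suc (Suc i))) = c (Suc (Suc i)) - (c (Suc i) - c i) \<Longrightarrow> adjacent (c i) (c (Suc (Suc (Suc i))))"
      using unit_step[of "Suc i"] i
      by (cases "c i"; cases "c (Suc i)"; cases "c (Suc (Suc i))") (auto simp: adjacent_cases)
    ultimately have ne: "c (Suc (Suc (Suc i))) - c (Suc (Suc i)) \<noteq> - (c (Suc i) - c i)" by (auto simp: algebra_simps)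
    have "adjacent (0, 0) (c (Suc i) - c i)" "adjacent (0, 0) (c (Suc (Suc i)) - c (Suc i))"
      "adjacent (0, 0) (c (Suc (Suc (Suc i))) - c (Suc (Suc i)))"
      using unit_step i by simp_all
    then show ?thesis using ne opp[of i] opp[of "Suc i"] turned[of i] turned[of "Suc i"] i
      unfolding adjacent_offsets by (elim disjE) simp_all
  qed
  have step: "(Suc (2 * i) < n \<longrightarrow> c (Suc (2 * i)) - c (2 * i) = d) \<and>
      (Suc (Suc (2 * i)) < n \<longrightarrow> c (Suc (Suc (2 * i))) - c (Suc (2 * i)) = d')" for i
  proof (induction i)
    case 0
    then show ?case by (simp add: d_def d'_def numeral_2_eq_2)
  next
    case (Suc i)
    then show ?case using alternate[of "2 * i"] alternate[of "Suc (2 * i)"] by simp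
  qed
  have pos: "c i = place (c 0) d d' (int ((i + 1) div 2), int (i div 2))" if "i < n" for i
    using that
  proof (induction i)
    case (Suc i)
    show ?case
    proof (cases "even i")
      case True
      then obtain k where k: "i = 2 * k" by (elim evenE)
      then have "c (Suc i) = c i + d" using step[of k] Suc.prems by (simp add: algebra_simps)
      with Suc k show ?thesis by (simp add: place_def prod_eq_iff algebra_simps)
    next
      case False
      then obtain k where k: "i = Suc (2 * k)" by (metis oddE Suc_eq_plus1)
      then have "c (Suc i) = c i + d'" using step[of k] Suc.prems by (simp add: algebra_simps)
      with Suc k show ?thesis by (simp add: place_def prod_eq_iff algebra_simps)
    qed
  qed (simp add: place_def)
  have eq: "cells = place (c 0) d d' ` (\<lambda>i. (int ((i + 1) div 2), int (i div 2))) ` {..<n}"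
    unfolding image_image by (rule image_cong[OF refl], rule pos, simp)
  show ?thesis by (subst eq) (rule graph_iso_place[OF d perp])
qed

text \<open>Neither \<open>L\<close> nor \<open>Z\<close> is assumed to lie in \<open>Omega\<close>,
  so \<open>no_U\<close> is derived for them from their turns.\<close>

lemma straight_no_U:
  assumes "\<forall>i<n. \<not> turn i"
  shows "no_U"
  unfolding no_U_def
proof (intro allI impI notI)
  fix i
  assume i: "i + 4 < n" and U: "c (i + 3) - c (i + 2) = c (i + 2) - c (i + 1) \<and> c i - c (i + 1) = c (i + 4) - c (i + 3)"
  have "\<not> turn (i + 1)" using assms i by simp
  then have "c (i + 2) - c (i + 1) = c (i + 1) - c i" using i by (simp add: turn_def)
  then have "c (i + 4) = c (i + 2)" using U by (auto simp: prod_eq_iff)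
  then show False using i by (simp add: c_eq)
qed

lemma zigzag_no_U:
  assumes "\<forall>i<n. turn i \<or> end_cell i"
  shows "no_U"
  unfolding no_U_def
proof (intro allI impI notI)
  fix i
  assume i: "i + 4 < n" and U: "c (i + 3) - c (i + 2) = c (i + 2) - c (i + 1) \<and> c i - c (i + 1) = c (i + 4) - c (i + 3)"
  have "turn (i + 2)" using assms[rule_format, of "i + 2"] i by (auto simp: end_cell_def)
  then show False using i U by (simp add: turn_def numeral_eq_Suc)
qed

end

theorem proposition2p4:
  fixes x0 \<alpha> :: real and n :: nat and B Z L :: "cell set"
  assumes root: "2 * 5 powr x0 - 6 powr (x0 + 1) + 4 * 7 powr x0 = 0"
    and approx: "\<bar>x0 - (- 3.09997)\<bar> < 1 / 10 ^ 5"
    and alpha: "x0 < \<alpha>" "\<alpha> < 0"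
    and n: "n \<ge> 3"
    and B: "B \<in> Omega n"
    and Z: "zigzag_chain Z" "card Z = n"
    and L: "linear_chain L" "card L = n"
  shows "sum_connectivity \<alpha> (graph_of Z) \<le> sum_connectivity \<alpha> (graph_of B) \<and>
         sum_connectivity \<alpha> (graph_of B) \<le> sum_connectivity \<alpha> (graph_of L) \<and>
         (sum_connectivity \<alpha> (graph_of B) = sum_connectivity \<alpha> (graph_of L) \<longleftrightarrow>
            graph_iso (graph_of B) (graph_of L)) \<and>
         (sum_connectivity \<alpha> (graph_of Z) = sum_connectivity \<alpha> (graph_of B) \<longleftrightarrow>
            graph_iso (graph_of B) (graph_of Z))"
proof -
  have "polyomino_chain B" "card B = n" using B by (auto simp: Omega_def)
  then obtain b where b: "cell_path b n" "B = b ` {..<n}" using polyomino_chain_cell_path by metis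
  obtain z where z: "cell_path z n" "Z = z ` {..<n}"
    using Z polyomino_chain_cell_path[of Z] unfolding zigzag_chain_def by metis
  obtain l where l: "cell_path l n" "L = l ` {..<n}"
    using L polyomino_chain_cell_path[of L] unfolding linear_chain_def by metis
  interpret B: cell_path b n by fact
  interpret Z: cell_path z n by fact
  interpret L: cell_path l n by fact
  have n': "2 < n" "2 \<le> n" using n by simp_all
  have Bno: "B.no_U" using B.Omega_no_U B b(2) by simp
  have Lturn: "\<forall>i<n. \<not> L.turn i"
    using L(1) L.kink_iff_turn l(2) unfolding linear_chain_def by blast
  have Zturn: "\<forall>i<n. Z.turn i \<or> Z.end_cell i"
    using Z(1) Z.kink_iff_turn Z.terminal_iff n'(2) z(2) unfolding zigzag_chain_def by blast
  note Bb = B.sum_connectivity_bounds[OF root alpha n'(1) Bno, folded b(2)]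
  \<comment> \<open>The equality criterion, applied to \<open>L\<close> itself, evaluates its
    index.\<close>
  have Lv: "sum_connectivity \<alpha> (graph_of L) = linear_value \<alpha> n"
    using L.sum_connectivity_bounds(2)[OF root alpha n'(1) L.straight_no_U[OF Lturn], folded l(2)] Lturn by blast
  have Zv: "sum_connectivity \<alpha> (graph_of Z) = zigzag_value \<alpha> n"
    using Z.sum_connectivity_bounds(4)[OF root alpha n'(1) Z.zigzag_no_U[OF Zturn], folded z(2)] Zturn by metis
  have BL: "graph_iso (graph_of B) (graph_of L)" if "\<forall>i<n. \<not> B.turn i"
    using graph_iso_trans[OF graph_iso_sym[OF B.straight_iso[OF n'(2) that]] L.straight_iso[OF n'(2) Lturn]]
    unfolding b(2) l(2) .
  have BZ: "graph_iso (graph_of B) (graph_of Z)" if "\<forall>i<n. B.turn i \<or> B.end_cell i"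
    using graph_iso_trans[OF graph_iso_sym[OF B.zigzag_iso[OF n'(1) that]] Z.zigzag_iso[OF n'(1) Zturn]]
    unfolding b(2) z(2) .
  show ?thesis
  proof (intro conjI)
    show "sum_connectivity \<alpha> (graph_of Z) \<le> sum_connectivity \<alpha> (graph_of B)" using Bb(3) unfolding Zv .
    show "sum_connectivity \<alpha> (graph_of B) \<le> sum_connectivity \<alpha> (graph_of L)" using Bb(1) unfolding Lv .
    show "sum_connectivity \<alpha> (graph_of B) = sum_connectivity \<alpha> (graph_of L) \<longleftrightarrow> graph_iso (graph_of B) (graph_of L)"
      using Bb(2) BL sum_connectivity_iso[of B L \<alpha>] unfolding Lv by blast
    show "sum_connectivity \<alpha> (graph_of Z) = sum_connectivity \<alpha> (graph_of B) \<longleftrightarrow> graph_iso (graph_of B) (graph_of Z)"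
      using Bb(4) BZ sum_connectivity_iso[of B Z \<alpha>] unfolding Zv by auto
  qed
qed

end
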